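(* Let $\alpha>0$ and $n>0$, and let $\theta_0>0$ and $\Sigma_0>0$ be given. Set $c_0=e^{\alpha\theta_0}$, $\theta_s(t)=\frac1\alpha\log(\alpha t+c_0)$ and $\sigma_s(t)=\frac{1}{\alpha t+c_0}$. For any $\lambda>0$, the system $$ u_t=\sigma_{xx},\qquad \theta_t=\sigma u,\qquad \sigma=e^{-\alpha\theta}u^n,\qquad (x,t)\in\mathbb{R}\times\mathbb{R}^+, $$ admits a special class of solutions describing localization, of the form $$ u(x,t)=\Big(\tfrac{\alpha}{c_0}t+1\Big)^{\frac{\lambda}{\alpha}}\,U_\lambda\Big(\sqrt\lambda\,x\,\big(\tfrac{\alpha}{c_0}t+1\big)^{\frac\lambda\alpha}\Big), $$ $$ \sigma(x,t)=\sigma_s(t)\Big(\tfrac{\alpha}{c_0}t+1\Big)^{-\frac{\lambda}{\alpha}}\,\Sigma_\lambda\Big(\sqrt\lambda\,x\,\big(\tfrac{\alpha}{c_0}t+1\big)^{\frac\lambda\alpha}\Big), $$ $$ \theta(x,t)=\Big(1+\lambda\tfrac{n+1}{\alpha}\Big)\theta_s(t)-\lambda\tfrac{n+1}{\alpha}\theta_0+\Theta_\lambda\Big(\sqrt\lambda\,x\,\big(\tfrac{\alpha}{c_0}t+1\big)^{\frac\lambda\alpha}\Big), $$ where $(U_\lambda,\Sigma_\lambda,\Theta_\lambda)(\xi)$ is an even function defined on $\mathbb{R}$ which, for $\xi\in[0,\infty)$, solves the initial value problem $$ \Sigma'=\xi U,\qquad \lambda\Big(\tfrac{n+1}{\alpha}+\xi\Theta'\Big)=\Sigma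 U-1,\qquad \Sigma=e^{-\alpha\Theta}U^n,\qquad \Sigma(0)=\Sigma_0 . $$
   Context: The prime denotes $d/d\xi$; subscripts $t$ and $x$ denote partial derivatives. "Even" means that each of the three components is an even function of $\xi$. "Solution" means classical solution (all derivatives appearing in the equations exist and are continuous), with $u>0$ and $U_\lambda>0$ so that the $n$-th powers make sense. The pair $(\theta_s,\sigma_s)$, together with $u_s=1$, is the uniform shearing solution of the same system with $\theta_s(0)=\theta_0$. The words "describing localization" are descriptive: since $(\frac{\alpha}{c_0}t+1)^{\lambda/\alpha}\to\infty$ as $t\to\infty$, the level curves of $\xi(x,t)=\sqrt\lambda\,x\,(\frac{\alpha}{c_0}t+1)^{\lambda/\alpha}$ accumulate along the line $x=0$. *)

theory Defs
  imports "HOL-Analysis.Analysis"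
begin

text \<open>
  Classical solutions of \<open>u\<^sub>t = \<sigma>\<^sub>x\<^sub>x\<close>, \<open>\<theta>\<^sub>t = \<sigma> u\<close>, \<open>\<sigma> = exp (- \<alpha> \<theta>) u\<^sup>n\<close>, the unknowns being
  functions of \<open>x\<close> and \<open>t\<close> in this order.  The time half-line contains \<open>0\<close>, and the time
  derivatives at \<open>t = 0\<close> are one-sided.  The exponent \<open>n\<close> is real, hence \<open>powr\<close> and the positivity
  of \<open>u\<close>.
\<close>

definition classical_shear_solution ::
  "real \<Rightarrow> real \<Rightarrow> (real \<Rightarrow> real \<Rightarrow> real) \<Rightarrow> (real \<Rightarrow> real \<Rightarrow> real) \<Rightarrow> (real \<Rightarrow> real \<Rightarrow> real) \<Rightarrow> bool"
  where
  "classical_shear_solution \<alpha> n u \<sigma> \<theta> \<longleftrightarrow>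
    (\<forall>x. \<forall>t\<ge>0. u x t > 0) \<and>
    (\<forall>f\<in>{u, \<sigma>, \<theta>}. continuous_on (UNIV \<times> {0..}) (\<lambda>(x, t). f x t)) \<and>
    (\<exists>u\<^sub>t \<theta>\<^sub>t \<sigma>\<^sub>x \<sigma>\<^sub>x\<^sub>x.
      (\<forall>f\<in>{u\<^sub>t, \<theta>\<^sub>t, \<sigma>\<^sub>x, \<sigma>\<^sub>x\<^sub>x}. continuous_on (UNIV \<times> {0..}) (\<lambda>(x, t). f x t)) \<and>
      (\<forall>x. \<forall>t\<ge>0.
        ((\<lambda>s. u x s) has_real_derivative u\<^sub>t x t) (at t within {0..}) \<and>
        ((\<lambda>s. \<theta> x s) has_real_derivative \<theta>\<^sub>t x t) (at t within {0..}) \<and>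
        ((\<lambda>y. \<sigma> y t) has_real_derivative \<sigma>\<^sub>x x t) (at x) \<and>
        ((\<lambda>y. \<sigma>\<^sub>x y t) has_real_derivative \<sigma>\<^sub>x\<^sub>x x t) (at x) \<and>
        u\<^sub>t x t = \<sigma>\<^sub>x\<^sub>x x t \<and>
        \<theta>\<^sub>t x t = \<sigma> x t * u x t \<and>
        \<sigma> x t = exp (- \<alpha> * \<theta> x t) * u x t powr n))"

text \<open>
  The initial value problem for the profile \<open>(U, \<Sigma>, \<Theta>)\<close> on \<open>[0, \<infinity>)\<close>; derivatives at \<open>\<xi> = 0\<close> are
  one-sided.
\<close>

definition solves_profile_ivp ::
  "real \<Rightarrow> real \<Rightarrow> real \<Rightarrow> real \<Rightarrow> (real \<Rightarrow> real) \<Rightarrow> (real \<Rightarrow> real) \<Rightarrow> (real \<Rightarrow> real) \<Rightarrow> bool"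
  where
  "solves_profile_ivp \<alpha> n lam \<Sigma>\<^sub>0 U \<Sigma> \<Theta> \<longleftrightarrow>
    (\<forall>\<xi>\<ge>0. U \<xi> > 0) \<and>
    continuous_on {0..} U \<and>
    (\<exists>\<Sigma>' \<Theta>'.
      continuous_on {0..} \<Sigma>' \<and> continuous_on {0..} \<Theta>' \<and>
      (\<forall>\<xi>\<ge>0.
        (\<Sigma> has_real_derivative \<Sigma>' \<xi>) (at \<xi> within {0..}) \<and>
        (\<Theta> has_real_derivative \<Theta>' \<xi>) (at \<xi> within {0..}) \<and>
        \<Sigma>' \<xi> = \<xi> * U \<xi> \<and>
        lam * ((n + 1) / \<alpha> + \<xi> * \<Theta>' \<xi>) = \<Sigma> \<xi> * U \<xi> - 1 \<and>
        \<Sigma> \<xi> = exp (- \<alpha> * \<Theta> \<xi>) * U \<xi> powr n)) \<and>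
    \<Sigma> 0 = \<Sigma>\<^sub>0"

definition even_function :: "(real \<Rightarrow> real) \<Rightarrow> bool" where
  "even_function f \<longleftrightarrow> (\<forall>\<xi>. f (- \<xi>) = f \<xi>)"

end

theory Submission
  imports Defs
begin

text \<open>
  With \<open>A = \<alpha> / lam\<close>, eliminating \<open>\<Theta>\<close> turns the profile problem into \<open>\<Sigma>' = x / W\<close>,
  \<open>x W' = r W - (A \<Sigma> + x\<^sup>2 / \<Sigma>) / n\<close> for the reciprocal \<open>W = 1 / U\<close>, where \<open>r = (A + n + 1) / n > 1\<close>.
  The second equation is linear in \<open>W\<close>, so \<open>W = x powr r * V\<close> where \<open>V\<close> is a constant \<open>C\<close> plus the
  integral of \<open>s powr (-r - 1) * (A \<Sigma> + s\<^sup>2 / \<Sigma>) / n\<close> from \<open>x\<close> to infinity.  The problem is singular at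
  \<open>0\<close> and its solutions there form a one-parameter family, with parameter \<open>C\<close>; for large \<open>C\<close> the
  map \<open>\<Sigma> \<mapsto> W \<mapsto> \<Sigma>\<close> is a contraction on the whole half-line, which gives a global positive solution.
  L'Hopital's rule at \<open>0\<close> shows that \<open>W\<close> has a positive limit and \<open>W'\<close> tends to \<open>0\<close>, hence the
  even extension is continuously differentiable.
\<close>

section \<open>Tail integrals\<close>

text \<open>The weight is the integrating factor of \<open>x * W' = r * W - g x\<close>: with
  \<open>W = x powr r * V\<close> the equation becomes
  \<open>V' = - (x powr (-r - 1) * g x)\<close>, which this integral solves with limit 0 at infinity
  whenever it converges.\<close>

definition tail_integral :: "real \<Rightarrow> (real \<Rightarrow> real) \<Rightarrow> real \<Rightarrow> real" where
  "tail_integral r g x = integral {x..} (\<lambda>s. s powr (-r - 1) * g s)"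

lemma has_integral_powr_tail:
  fixes c x :: real
  assumes "c > 0" "x > 0"
  shows "((\<lambda>s. s powr (-c - 1)) has_integral x powr (-c) / c) {x..}"
  using has_integral_powr_to_inf[of "-c - 1" x] assms by (simp add: field_simps)

text \<open>Growth of \<open>g\<close> below the exponent \<open>r\<close> makes the tails converge.
  The bound in powers of \<open>1 + s\<close> describes the growth at infinity and the boundedness
  near 0 at once.\<close>

locale tail_integrand =
  fixes r m K :: real and g :: "real \<Rightarrow> real"
  assumes m: "0 \<le> m" "m < r"
    and cont: "continuous_on {0<..} g"
    and bound: "\<And>s. s > 0 \<Longrightarrow> \<bar>g s\<bar> \<le> K * (1 + s) powr m"
begin

lemma K_nonneg: "K \<ge> 0"
proof -
  have "0 \<le> K * 2 powr m"
    using bound[of 1] by simp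
  then show ?thesis
    by (simp add: zero_le_mult_iff)
qed

lemma cont_integrand: "continuous_on {0<..} (\<lambda>s. s powr (-r - 1) * g s)"
  using cont by (auto intro!: continuous_intros)

text \<open>The quotient \<open>(1 + s) / s\<close> decreases in \<open>s\<close>, so on
  \<open>{x..}\<close> it is at most its value at \<open>x\<close>. This trades the power of
  \<open>1 + s\<close> for a pure power of \<open>s\<close>, whose tail integral is
  explicit.\<close>

lemma integrand_le:
  assumes "0 < x" "x \<le> s"
  shows "\<bar>s powr (-r - 1) * g s\<bar> \<le> K * ((1 + x) / x) powr m * s powr (-(r - m) - 1)"
proof -
  have s: "s > 0" using assms by simp
  have "1 + s \<le> ((1 + x) / x) * s"
    using assms by (simp add: field_simps)
  then have "(1 + s) powr m \<le> (((1 + x) / x) * s) powr m"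
    using m s by (intro powr_mono2) auto
  also have "\<dots> = ((1 + x) / x) powr m * s powr m"
    using assms s by (subst powr_mult) auto
  finally have "\<bar>g s\<bar> \<le> K * (((1 + x) / x) powr m * s powr m)"
    using bound[OF s] K_nonneg by (meson mult_left_mono order_trans)
  then have "s powr (-r - 1) * \<bar>g s\<bar> \<le> s powr (-r - 1) * (K * (((1 + x) / x) powr m * s powr m))"
    by (intro mult_left_mono) auto
  also have "\<dots> = K * ((1 + x) / x) powr m * (s powr (-r - 1) * s powr m)"
    by (simp add: algebra_simps)
  also have "s powr (-r - 1) * s powr m = s powr (-(r - m) - 1)"
    by (simp add: algebra_simps flip: powr_add)
  finally show ?thesis
    by (simp add: abs_mult)
qed

lemma integrable_bound:
  assumes "x > 0"
  shows "((\<lambda>s. K * ((1 + x) / x) powr m * s powr (-(r - m) - 1)) has_integral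
           K / (r - m) * (1 + x) powr m * x powr (-r)) {x..}"
proof -
  have "((\<lambda>s. K * ((1 + x) / x) powr m * s powr (-(r - m) - 1)) has_integral
           K * ((1 + x) / x) powr m * (x powr (-(r - m)) / (r - m))) {x..}"
    using m assms by (intro has_integral_mult_right has_integral_powr_tail) auto
  moreover have "K * ((1 + x) / x) powr m * (x powr (-(r - m)) / (r - m))
      = K / (r - m) * (1 + x) powr m * x powr (-r)"
  proof -
    have "((1 + x) / x) powr m = (1 + x) powr m * x powr (-m)"
      using assms by (simp add: powr_divide powr_minus_divide)
    moreover have "x powr (-r) = x powr (-m) * x powr (-(r - m))"
      by (simp flip: powr_add)
    ultimately show ?thesis by simp
  qed
  ultimately show ?thesis by (simp only:)
qed

lemma integrable:
  assumes "x > 0"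
  shows "(\<lambda>s. s powr (-r - 1) * g s) integrable_on {x..}"
proof (rule measurable_bounded_by_integrable_imp_integrable)
  have "continuous_on {x..} (\<lambda>s. s powr (-r - 1) * g s)"
    by (rule continuous_on_subset[OF cont_integrand]) (use assms in auto)
  then show "(\<lambda>s. s powr (-r - 1) * g s) \<in> borel_measurable (lebesgue_on {x..})"
    by (rule continuous_imp_measurable_on_sets_lebesgue) auto
  show "(\<lambda>s. K * ((1 + x) / x) powr m * s powr (-(r - m) - 1)) integrable_on {x..}"
    using integrable_bound[OF assms] by (rule has_integral_integrable)
qed (use integrand_le assms in auto)

lemma tail_le:
  assumes "x > 0"
  shows "\<bar>tail_integral r g x\<bar> \<le> K / (r - m) * (1 + x) powr m * x powr (-r)"
proof -
  have "norm (integral {x..} (\<lambda>s. s powr (-r - 1) * g s))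
      \<le> integral {x..} (\<lambda>s. K * ((1 + x) / x) powr m * s powr (-(r - m) - 1))"
    using integrand_le integrable integrable_bound[OF assms] assms
    by (intro integral_norm_bound_integral) (auto intro: has_integral_integrable)
  with integral_unique[OF integrable_bound[OF assms]] show ?thesis
    by (simp add: tail_integral_def)
qed

lemma tail_ge:
  assumes "x > 0" and "\<And>s. s > 0 \<Longrightarrow> h \<le> g s"
  shows "h / r * x powr (-r) \<le> tail_integral r g x"
proof -
  have "((\<lambda>s. h * s powr (-r - 1)) has_integral h * (x powr (-r) / r)) {x..}"
    using m assms by (intro has_integral_mult_right has_integral_powr_tail) auto
  moreover have "((\<lambda>s. s powr (-r - 1) * g s) has_integral tail_integral r g x) {x..}"
    unfolding tail_integral_def using integrable[OF assms(1)] by (rule integrable_integral)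
  moreover have "h * s powr (-r - 1) \<le> s powr (-r - 1) * g s" if "s \<in> {x..}" for s
    using assms that by (subst mult.commute) (intro mult_left_mono, auto)
  ultimately have "h * (x powr (-r) / r) \<le> tail_integral r g x"
    by (rule has_integral_le)
  then show ?thesis by simp
qed

text \<open>Writes the improper integral as a constant minus an integral over a compact interval, to
  which the fundamental theorem of calculus applies.\<close>

lemma tail_split:
  assumes "0 < a" "a \<le> x"
  shows "tail_integral r g x = tail_integral r g a - integral {a..x} (\<lambda>s. s powr (-r - 1) * g s)"
proof -
  have "(\<lambda>s. s powr (-r - 1) * g s) integrable_on {a..x}"
    by (intro integrable_continuous_interval continuous_on_subset[OF cont_integrand])
      (use assms in auto)
  then have "((\<lambda>s. s powr (-r - 1) * g s) has_integral
      integral {a..x} (\<lambda>s. s powr (-r - 1) * g s) + tail_integral r g x) ({a..x} \<union> {x..})"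
    unfolding tail_integral_def using integrable[of x] assms
    by (intro has_integral_Un integrable_integral) auto
  moreover have "{a..x} \<union> {x..} = {a..}" using assms by auto
  ultimately show ?thesis
    by (simp add: tail_integral_def integral_unique)
qed

lemma tail_deriv:
  assumes "x > 0"
  shows "(tail_integral r g has_real_derivative - (x powr (-r - 1) * g x)) (at x)"
proof -
  \<comment> \<open>Any base point strictly between 0 and \<open>x\<close> would do: the integrand
    is continuous from \<open>a\<close> on, and \<open>x\<close> is interior to
    \<open>{a..x + 1}\<close>.\<close>
  define a where "a = x / 2"
  have a: "0 < a" "a < x" using assms by (auto simp: a_def)
  let ?f = "\<lambda>s. s powr (-r - 1) * g s"
  have "continuous_on {a..x + 1} ?f"
    by (rule continuous_on_subset[OF cont_integrand]) (use a in auto)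
  from integral_has_real_derivative[OF this, of x]
  have "((\<lambda>y. integral {a..y} ?f) has_real_derivative ?f x) (at x)"
    using a at_within_Icc_at[of a x "x + 1"] by simp
  from DERIV_diff[OF DERIV_const[of "tail_integral r g a"] this]
  have *: "((\<lambda>y. tail_integral r g a - integral {a..y} ?f) has_real_derivative - ?f x) (at x)"
    by simp
  have "tail_integral r g a - integral {a..y} ?f = tail_integral r g y" if "a < y" for y
    by (rule tail_split[OF a(1) less_imp_le[OF that], symmetric])
  then show ?thesis
    by (intro has_field_derivative_transform_within_open[OF * open_greaterThan[of a]])
      (use a in simp_all)
qed

end

section \<open>The contraction\<close>

text \<open>Since \<open>1 + s \<le> 2 * max 1 s\<close>, the power is at most a multiple of
  \<open>s powr r + 1\<close>, and the positive constant \<open>v\<close> can take the place of 1.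
  With \<open>v = h / r\<close> the right-hand side is comparable to the denominator of the Picard
  map.\<close>

lemma powr_one_plus_le:
  fixes r v :: real
  assumes "r > 0" "v > 0"
  obtains B where "B > 0" "\<And>s. s \<ge> 0 \<Longrightarrow> (1 + s) powr r \<le> B * (s powr r + v)"
proof
  show "2 powr r * (1 + 1 / v) > 0"
    using assms by (intro mult_pos_pos add_pos_pos) auto
  fix s :: real
  assume s: "s \<ge> 0"
  have "(1 + s) powr r \<le> (2 * max 1 s) powr r"
    using s assms by (intro powr_mono2) auto
  also have "\<dots> = 2 powr r * (max 1 s) powr r"
    using s by (subst powr_mult) auto
  also have "(max 1 s) powr r \<le> s powr r + 1"
    by (cases "s \<le> 1") (auto simp: max_def)
  also have "s powr r + 1 \<le> (1 + 1 / v) * (s powr r + v)"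
    using assms by (simp add: algebra_simps)
  finally show "(1 + s) powr r \<le> 2 powr r * (1 + 1 / v) * (s powr r + v)"
    by (simp add: mult.assoc)
qed

section \<open>Primitives of bounded functions against a power weight\<close>

text \<open>The weight lets the Picard iteration act on bounded functions while the primitive may
  grow like \<open>(1 + x) powr k\<close>; the sup norm of \<open>f\<close> is thus a weighted norm
  of the derivative.\<close>

definition weighted_primitive :: "real \<Rightarrow> (real \<Rightarrow> real) \<Rightarrow> real \<Rightarrow> real" where
  "weighted_primitive k f x = integral {0..x} (\<lambda>s. f s * (1 + s) powr (k - 1))"

context
  fixes k :: real
  assumes k: "k > 0"
begin

lemma weighted_cont:
  "continuous_on UNIV f \<Longrightarrow> continuous_on {0..x} (\<lambda>s. f s * (1 + s) powr (k - 1))"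
  for f :: "real \<Rightarrow> real"
  by (intro continuous_intros) (auto intro: continuous_on_subset)

lemma weighted_primitive_le:
  assumes f: "continuous_on UNIV f" "\<And>s. \<bar>f s\<bar> \<le> d" and x: "x \<ge> 0"
  shows "\<bar>weighted_primitive k f x\<bar> \<le> d / k * (1 + x) powr k"
proof -
  have d: "d \<ge> 0" using f(2)[of 0] by linarith
  have "((\<lambda>s. (1 + s) powr (k - 1)) has_integral (1 + x) powr k / k - (1 + 0) powr k / k) {0..x}"
    using x k by (intro fundamental_theorem_of_calculus)
      (auto simp flip: has_real_derivative_iff_has_vector_derivative intro!: derivative_eq_intros)
  from has_integral_mult_right[OF this, of d]
  have I: "((\<lambda>s. d * (1 + s) powr (k - 1)) has_integral d * ((1 + x) powr k / k - 1 / k)) {0..x}"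
    by simp
  have "norm (weighted_primitive k f x) \<le> integral {0..x} (\<lambda>s. d * (1 + s) powr (k - 1))"
    unfolding weighted_primitive_def
    using f(2) has_integral_integrable[OF I] weighted_cont[OF f(1)]
    by (intro integral_norm_bound_integral)
      (auto simp: abs_mult intro: mult_right_mono integrable_continuous_interval)
  also have "\<dots> = d * ((1 + x) powr k / k - 1 / k)"
    by (rule integral_unique[OF I])
  also have "\<dots> \<le> d / k * (1 + x) powr k"
    using d k by (simp add: algebra_simps)
  finally show ?thesis by simp
qed

lemma weighted_primitive_nonneg:
  assumes "continuous_on UNIV f" "\<And>s. 0 \<le> f s"
  shows "0 \<le> weighted_primitive k f x"
  unfolding weighted_primitive_def using assms weighted_cont[OF assms(1)]
  by (intro integral_nonneg integrable_continuous_interval) auto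

lemma weighted_primitive_diff:
  assumes "continuous_on UNIV f" "continuous_on UNIV g"
  shows "weighted_primitive k f x - weighted_primitive k g x = weighted_primitive k (\<lambda>s. f s - g s) x"
  unfolding weighted_primitive_def
  using weighted_cont[OF assms(1)] weighted_cont[OF assms(2)]
  by (subst integral_diff[symmetric]) (auto intro!: integrable_continuous_interval simp: algebra_simps)

lemma weighted_primitive_continuous:
  assumes "continuous_on UNIV f"
  shows "continuous_on {0..} (weighted_primitive k f)"
proof -
  have "continuous (at x within {0..}) (weighted_primitive k f)" if "x \<ge> 0" for x
  proof -
    have "continuous_on {0..x + 1} (weighted_primitive k f)"
      unfolding weighted_primitive_def
      by (intro indefinite_integral_continuous_1 integrable_continuous_interval weighted_cont assms)
    then have "continuous (at x within {0..x + 1}) (weighted_primitive k f)"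
      using that by (simp add: continuous_on_eq_continuous_within)
    moreover have "at x within {0..x + 1} = at x within {0..}"
      by (rule at_within_nhd[of _ "{..<x + 1}"]) auto
    ultimately show ?thesis by simp
  qed
  then show ?thesis
    by (simp add: continuous_on_eq_continuous_within)
qed

lemma weighted_primitive_deriv:
  assumes "continuous_on UNIV f" and x: "x > 0"
  shows "(weighted_primitive k f has_real_derivative f x * (1 + x) powr (k - 1)) (at x)"
proof -
  have "((\<lambda>y. integral {0..y} (\<lambda>s. f s * (1 + s) powr (k - 1))) has_real_derivative
      f x * (1 + x) powr (k - 1)) (at x within {0..x + 1})"
    using integral_has_real_derivative[OF weighted_cont[OF assms(1)], of x "x + 1"] x by simp
  then show ?thesis
    using x at_within_Icc_at[of 0 x "x + 1"] by (simp add: weighted_primitive_def[abs_def])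
qed

end

section \<open>Contraction argument for an abstract source term\<close>

text \<open>The abstract problem is \<open>y' = x / Y\<close>,
  \<open>x * Y' = r * Y - H x y\<close>, \<open>y 0 = 0\<close>. The exponent \<open>k\<close>
  limits the growth of \<open>y\<close> and \<open>m\<close> that of the source; the Lipschitz
  factor has exponent \<open>m - k\<close> because differences of two candidates \<open>y\<close>
  may themselves grow like \<open>(1 + x) powr k\<close>. The condition \<open>m < r\<close> makes
  the tail integrals converge, and \<open>2 - r \<le> k\<close> keeps the iterates bounded at
  infinity.\<close>

locale shear_contraction =
  fixes r m k K h :: real and H :: "real \<Rightarrow> real \<Rightarrow> real"
  assumes r: "r > 1" and m: "0 \<le> m" "m < r" and k: "k > 0" "2 - r \<le> k" and h: "h > 0" and K: "K \<ge> 0"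
    and H_cont: "continuous_on ({0..} \<times> {0..}) (\<lambda>(x, y). H x y)"
    and H_ge: "\<And>x y. x \<ge> 0 \<Longrightarrow> 0 \<le> y \<Longrightarrow> h \<le> H x y"
    and H_0: "\<And>x. x \<ge> 0 \<Longrightarrow> H x 0 \<le> K * (1 + x) powr m"
    and H_lip: "\<And>x y z. x \<ge> 0 \<Longrightarrow> y \<in> {0..(1 + x) powr k} \<Longrightarrow> z \<in> {0..(1 + x) powr k} \<Longrightarrow>
      \<bar>H x y - H x z\<bar> \<le> K * (1 + x) powr (m - k) * \<bar>y - z\<bar>"
begin

text \<open>The upper bound \<open>k\<close> is the one for which the weighted primitive stays below
  \<open>(1 + x) powr k\<close>, the range in which \<open>H_lip\<close> applies. Functions live on
  the whole line in order to fit the type of bounded continuous functions.\<close>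

definition admissible :: "(real \<Rightarrow> real) \<Rightarrow> bool" where
  "admissible f \<longleftrightarrow> continuous_on UNIV f \<and> (\<forall>s. f s \<in> {0..k})"

definition source :: "(real \<Rightarrow> real) \<Rightarrow> real \<Rightarrow> real" where
  "source f s = H s (weighted_primitive k f s)"

text \<open>This is the factor \<open>V\<close> in \<open>Y = x powr r * V\<close>, with the free
  constant \<open>C\<close> as its limit at infinity.\<close>

definition velocity :: "real \<Rightarrow> (real \<Rightarrow> real) \<Rightarrow> real \<Rightarrow> real" where
  "velocity C f x = C + tail_integral r (source f) x"

text \<open>The new derivative \<open>x / Y = x powr (1 - r) / V\<close>, divided by the weight
  \<open>(1 + x) powr (k - 1)\<close> of the primitive. The value 0 on the left half-line agrees
  with the limit at 0 from the right.\<close>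

definition picard :: "real \<Rightarrow> (real \<Rightarrow> real) \<Rightarrow> real \<Rightarrow> real" where
  "picard C f x = (if x \<le> 0 then 0 else (1 + x) powr (1 - k) * x powr (1 - r) / velocity C f x)"

lemma primitive_bounds:
  assumes "admissible f" "x \<ge> 0"
  shows "weighted_primitive k f x \<in> {0..(1 + x) powr k}"
  using assms weighted_primitive_le[OF k(1), of f k x] weighted_primitive_nonneg[OF k(1), of f x] k
  by (auto simp: admissible_def)

lemma source_cont:
  assumes "admissible f"
  shows "continuous_on {0..} (source f)"
proof -
  have c: "continuous_on {0..} (weighted_primitive k f)"
    using assms k by (intro weighted_primitive_continuous) (auto simp: admissible_def)
  have "continuous_on {0..} ((\<lambda>(x, y). H x y) \<circ> (\<lambda>x. (x, weighted_primitive k f x)))"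
    by (intro continuous_on_compose continuous_intros c continuous_on_subset[OF H_cont])
      (use primitive_bounds[OF assms] in auto)
  then show ?thesis
    by (simp add: source_def[abs_def] o_def)
qed

lemma source_ge: "admissible f \<Longrightarrow> s \<ge> 0 \<Longrightarrow> h \<le> source f s"
  using primitive_bounds[of f s] by (auto simp: source_def intro!: H_ge)

text \<open>The exponent \<open>m - k\<close> from the Lipschitz condition and the exponent
  \<open>k\<close> from the difference of the primitives add up to \<open>m\<close>.\<close>

lemma source_diff:
  assumes f: "admissible f" and g: "admissible g" and d: "\<And>s. \<bar>f s - g s\<bar> \<le> d" and s: "s \<ge> 0"
  shows "\<bar>source f s - source g s\<bar> \<le> K * d / k * (1 + s) powr m"
proof -
  have "\<bar>source f s - source g s\<bar>
      \<le> K * (1 + s) powr (m - k) * \<bar>weighted_primitive k f s - weighted_primitive k g s\<bar>"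
    unfolding source_def by (intro H_lip s primitive_bounds f g)
  also have "\<bar>weighted_primitive k f s - weighted_primitive k g s\<bar> \<le> d / k * (1 + s) powr k"
    using f g weighted_primitive_le[OF k(1), of "\<lambda>s. f s - g s" d s] d s k
    by (subst weighted_primitive_diff) (auto intro!: continuous_intros simp: admissible_def)
  also have "K * (1 + s) powr (m - k) * (d / k * (1 + s) powr k)
      = K * d / k * ((1 + s) powr (m - k) * (1 + s) powr k)"
    by simp
  also have "(1 + s) powr (m - k) * (1 + s) powr k = (1 + s) powr m"
    by (simp flip: powr_add)
  finally show ?thesis
    using K by (simp add: mult_left_mono)
qed

lemma source_le:
  assumes "admissible f" "s \<ge> 0"
  shows "source f s \<le> 2 * K * (1 + s) powr m"
proof -
  \<comment> \<open>Comparison with the zero function: \<open>H_0\<close> contributes one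
    \<open>K\<close>, and the Lipschitz bound with \<open>d = k\<close> the other.\<close>
  have z: "admissible (\<lambda>_. 0)" using k by (simp add: admissible_def)
  have "\<bar>source f s - source (\<lambda>_. 0) s\<bar> \<le> K * k / k * (1 + s) powr m"
    using assms(1) by (intro source_diff assms z) (auto simp: admissible_def)
  moreover have "source (\<lambda>_. 0) s \<le> K * (1 + s) powr m"
    using H_0[OF assms(2)] by (simp add: source_def weighted_primitive_def)
  ultimately show ?thesis using k by simp
qed

lemma tail_integrand_source:
  assumes "admissible f"
  shows "tail_integrand r m (2 * K) (source f)"
proof
  show "continuous_on {0<..} (source f)"
    by (rule continuous_on_subset[OF source_cont[OF assms]]) auto
  show "\<bar>source f s\<bar> \<le> 2 * K * (1 + s) powr m" if "s > 0" for s
    using source_ge[OF assms, of s] source_le[OF assms, of s] h that by auto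
qed (use m in auto)

text \<open>The constant source \<open>h\<close> has the tail \<open>h / r * x powr (-r)\<close>.
  With \<open>x powr (-r)\<close> pulled out, the remaining factor can be compared with
  \<open>(1 + x) powr r\<close>, uniformly from 0 to infinity.\<close>

lemma velocity_ge:
  assumes "admissible f" "x > 0"
  shows "x powr (-r) * (C * x powr r + h / r) \<le> velocity C f x"
proof -
  interpret tail_integrand r m "2 * K" "source f"
    by (rule tail_integrand_source[OF assms(1)])
  have "h / r * x powr (-r) \<le> tail_integral r (source f) x"
    using source_ge[OF assms(1)] assms by (intro tail_ge) auto
  moreover have "x powr (-r) * (C * x powr r + h / r) = C + h / r * x powr (-r)"
    using assms by (simp add: powr_minus field_simps)
  ultimately show ?thesis
    by (simp add: velocity_def)
qed

lemma velocity_pos: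
  assumes "admissible f" "x > 0" "C \<ge> 0"
  shows "velocity C f x > 0"
proof -
  have "0 < x powr (-r) * (C * x powr r + h / r)"
    using assms h r by (intro mult_pos_pos add_nonneg_pos) auto
  with velocity_ge[OF assms(1,2), of C] show ?thesis by linarith
qed

lemma velocity_deriv:
  assumes "admissible f" "x > 0"
  shows "(velocity C f has_real_derivative - (x powr (-r - 1) * source f x)) (at x)"
proof -
  interpret tail_integrand r m "2 * K" "source f"
    by (rule tail_integrand_source[OF assms(1)])
  show ?thesis
    unfolding velocity_def[abs_def] using DERIV_add[OF DERIV_const tail_deriv[OF assms(2)]] by simp
qed

lemma velocity_diff:
  assumes f: "admissible f" and g: "admissible g" and d: "\<And>s. \<bar>f s - g s\<bar> \<le> d" and x: "x > 0"
  shows "\<bar>velocity C f x - velocity C g x\<bar> \<le> K * d / (k * (r - m)) * (1 + x) powr m * x powr (-r)"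
proof -
  interpret F: tail_integrand r m "2 * K" "source f" by (rule tail_integrand_source[OF f])
  interpret G: tail_integrand r m "2 * K" "source g" by (rule tail_integrand_source[OF g])
  interpret D: tail_integrand r m "K * d / k" "\<lambda>s. source f s - source g s"
  proof
    show "\<bar>source f s - source g s\<bar> \<le> K * d / k * (1 + s) powr m" if "s > 0" for s
      using source_diff[OF f g d] that by simp
  qed (use m F.cont G.cont in \<open>auto intro!: continuous_intros\<close>)
  have "tail_integral r (source f) x - tail_integral r (source g) x
      = tail_integral r (\<lambda>s. source f s - source g s) x"
    unfolding tail_integral_def using F.integrable[OF x] G.integrable[OF x]
    by (subst integral_diff[symmetric]) (auto simp: algebra_simps)
  with D.tail_le[OF x] show ?thesis
    by (simp add: velocity_def)
qed

lemma picard_eq: "x > 0 \<Longrightarrow> picard C f x = (1 + x) powr (1 - k) * x powr (1 - r) / velocity C f x"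
  by (simp add: picard_def)

lemma powr_one_minus: "x > 0 \<Longrightarrow> x powr (1 - r) = x * x powr (-r)"
  using powr_add[of x 1 "-r"] by simp

lemma picard_nonneg: "admissible f \<Longrightarrow> C \<ge> 0 \<Longrightarrow> 0 \<le> picard C f x"
  using velocity_pos[of f x C] by (cases "x > 0") (auto simp: picard_def intro!: divide_nonneg_pos)

text \<open>
  The denominator is split as \<open>Z = Z powr (1 / r) * Z powr (1 - 1 / r)\<close>; the first factor
  supplies the smallness \<open>1 / M\<close>, the second one the decay in \<open>x\<close>.
\<close>

lemma picard_le:
  assumes f: "admissible f" and x: "x > 0" and M: "M \<ge> 1"
    and B: "B > 0" "\<And>s. s \<ge> 0 \<Longrightarrow> (1 + s) powr r \<le> B * (s powr r + h / r)"
  shows "picard (M powr r) f x \<le> B powr (1 - 1 / r) / M"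
proof -
  define Z where "Z = M powr r * x powr r + h / r"
  have hr: "h / r > 0" using h r by simp
  have Z: "Z > 0" unfolding Z_def using M x hr by (intro add_pos_pos mult_pos_pos) auto
  have "1 * x powr r \<le> M powr r * x powr r"
    using M r by (intro mult_right_mono ge_one_powr_ge_zero) auto
  then have "B * (x powr r + h / r) \<le> B * Z"
    using B(1) by (intro mult_left_mono) (auto simp: Z_def)
  with B(2)[of x] x have "(1 + x) powr r \<le> B * Z" by simp
  then have "(1 + x) powr r / B \<le> Z"
    using B(1) by (simp add: divide_le_eq mult.commute)
  then have "((1 + x) powr r / B) powr (1 - 1 / r) \<le> Z powr (1 - 1 / r)"
    using r B x by (intro powr_mono2) auto
  also have "((1 + x) powr r / B) powr (1 - 1 / r) = (1 + x) powr (r - 1) / B powr (1 - 1 / r)"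
    using r B x by (simp add: powr_divide powr_powr right_diff_distrib)
  finally have 1: "(1 + x) powr (r - 1) / B powr (1 - 1 / r) \<le> Z powr (1 - 1 / r)" .
  have "((M * x) powr r) powr (1 / r) \<le> Z powr (1 / r)"
    using r M x hr by (intro powr_mono2) (auto simp: Z_def powr_mult)
  then have 2: "M * x \<le> Z powr (1 / r)"
    using r M x by (simp add: powr_powr)
  have "(M * x) * ((1 + x) powr (r - 1) / B powr (1 - 1 / r)) \<le> Z powr (1 / r) * Z powr (1 - 1 / r)"
    using 1 2 M x by (intro mult_mono) auto
  also have "\<dots> = Z"
    using Z by (simp flip: powr_add)
  finally have 3: "M * x * (1 + x) powr (r - 1) \<le> B powr (1 - 1 / r) * Z"
    using B by (simp add: divide_le_eq mult.commute)
  have "picard (M powr r) f x \<le> (1 + x) powr (1 - k) * x powr (1 - r) / (x powr (-r) * Z)"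
    using velocity_ge[OF f x, of "M powr r"] x Z
    unfolding picard_eq[OF x] Z_def[symmetric] by (intro divide_left_mono mult_pos_pos velocity_pos f) auto
  also have "\<dots> = (1 + x) powr (1 - k) * x / Z"
    using x by (simp add: powr_one_minus)
  \<comment> \<open>The assumption \<open>2 - r \<le> k\<close> enters here, in the form
    \<open>1 - k \<le> r - 1\<close>.\<close>
  also have "\<dots> \<le> (1 + x) powr (r - 1) * x / Z"
    using k x Z by (intro divide_right_mono mult_right_mono powr_mono) auto
  also have "\<dots> \<le> B powr (1 - 1 / r) / M"
    using 3 M Z by (simp add: field_simps)
  finally show ?thesis .
qed

text \<open>The difference of the two quotients is \<open>picard C f x\<close> times the relative
  difference of the velocities. The latter is bounded uniformly in \<open>x\<close> and in
  \<open>C \<ge> 1\<close>, so the smallness of \<open>picard C f\<close> for large \<open>C\<close>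
  is what makes the map contract.\<close>

lemma picard_diff:
  assumes f: "admissible f" and g: "admissible g" and d: "\<And>s. \<bar>f s - g s\<bar> \<le> d" and x: "x > 0"
    and C: "C \<ge> 1"
    and B: "B > 0" "\<And>s. s \<ge> 0 \<Longrightarrow> (1 + s) powr r \<le> B * (s powr r + h / r)"
  shows "\<bar>picard C f x - picard C g x\<bar> \<le> picard C f x * (K * B / (k * (r - m)) * d)"
proof -
  have Vf: "velocity C f x > 0" and Vg: "velocity C g x > 0"
    using C velocity_pos f g x by auto
  have d0: "d \<ge> 0" using d[of 0] by linarith
  have "(1 + x) powr m \<le> (1 + x) powr r"
    using m x by (intro powr_mono) auto
  also have "\<dots> \<le> B * (x powr r + h / r)"
    using x by (intro B) auto
  also have "\<dots> \<le> B * (C * x powr r + h / r)"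
    using B C by (intro mult_left_mono add_right_mono) (auto simp: mult_le_cancel_right1)
  finally have "x powr (-r) * (1 + x) powr m \<le> x powr (-r) * (B * (C * x powr r + h / r))"
    by (intro mult_left_mono) auto
  then have "(1 + x) powr m * x powr (-r) \<le> B * (x powr (-r) * (C * x powr r + h / r))"
    by (simp add: mult_ac)
  also have "\<dots> \<le> B * velocity C g x"
    using velocity_ge[OF g x] B by (intro mult_left_mono) auto
  finally have 1: "(1 + x) powr m * x powr (-r) \<le> B * velocity C g x" .
  have "\<bar>velocity C g x - velocity C f x\<bar> \<le> K * d / (k * (r - m)) * ((1 + x) powr m * x powr (-r))"
    using velocity_diff[OF f g d x, of C] by (simp add: abs_minus_commute mult.assoc)
  also have "\<dots> \<le> K * d / (k * (r - m)) * (B * velocity C g x)"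
    using 1 K d0 k m by (intro mult_left_mono) auto
  finally have "\<bar>velocity C g x - velocity C f x\<bar> / velocity C g x \<le> K * B / (k * (r - m)) * d"
    using Vg by (simp add: divide_le_eq mult.commute mult.left_commute)
  then have "picard C f x * (\<bar>velocity C g x - velocity C f x\<bar> / velocity C g x)
      \<le> picard C f x * (K * B / (k * (r - m)) * d)"
    using f C by (intro mult_left_mono picard_nonneg) auto
  moreover have "picard C f x - picard C g x
      = picard C f x * ((velocity C g x - velocity C f x) / velocity C g x)"
    using Vf Vg x by (simp add: picard_eq field_simps)
  ultimately show ?thesis
    using Vg picard_nonneg[OF f, of C x] C by (simp add: abs_mult)
qed

lemma picard_continuous:
  assumes f: "admissible f" and C: "C \<ge> 0"
  shows "continuous_on UNIV (picard C f)"
proof -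
  have "continuous (at x) (picard C f)" for x
  proof -
    consider "x < 0" | "x = 0" | "x > 0" by linarith
    then show ?thesis
    proof cases
      case 1
      then have "eventually (\<lambda>y. picard C f y = 0) (nhds x)"
        by (intro eventually_nhds_in_open[of "{..<0}", THEN eventually_mono]) (auto simp: picard_def)
      then show ?thesis by (simp add: isCont_cong)
    next
      case 3
      then have *: "eventually (\<lambda>y. picard C f y = (1 + y) powr (1 - k) * y powr (1 - r) / velocity C f y) (nhds x)"
        by (intro eventually_nhds_in_open[of "{0<..}", THEN eventually_mono]) (auto simp: picard_def)
      have "isCont (velocity C f) x"
        using velocity_deriv[OF f 3] by (rule DERIV_isCont)
      then show ?thesis
        using 3 velocity_pos[OF f 3 C] by (subst isCont_cong[OF *]) (auto intro!: continuous_intros)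
    next
      case 2
      \<comment> \<open>The lower bound \<open>h / r * y powr (-r)\<close> for the velocity absorbs
        the singular factor \<open>y powr (1 - r)\<close> and leaves one power of \<open>y\<close>.
        The inner modulus makes the majorant continuous at 0 from both sides.\<close>
      have bound: "\<bar>picard C f y\<bar> \<le> \<bar>(1 + \<bar>y\<bar>) powr (1 - k) * y * (r / h)\<bar>" for y
      proof (cases "y \<le> 0")
        case False
        then have y: "y > 0" by simp
        have "y powr (-r) * (h / r) \<le> y powr (-r) * (C * y powr r + h / r)"
          using C by (intro mult_left_mono) auto
        also have "\<dots> \<le> velocity C f y" by (rule velocity_ge[OF f y])
        finally have "picard C f y \<le> (1 + y) powr (1 - k) * y powr (1 - r) / (y powr (-r) * (h / r))"
          using y h r unfolding picard_eq[OF y]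
          by (intro divide_left_mono mult_pos_pos velocity_pos f C) auto
        also have "\<dots> = (1 + y) powr (1 - k) * y * (r / h)"
          using y h r by (simp add: powr_one_minus)
        finally show ?thesis
          using picard_nonneg[OF f C, of y] y h r by simp
      qed (simp add: picard_def)
      have "isCont (\<lambda>y. \<bar>(1 + \<bar>y\<bar>) powr (1 - k) * y * (r / h)\<bar>) 0"
        by (intro continuous_intros) auto
      then have "((\<lambda>y. \<bar>(1 + \<bar>y\<bar>) powr (1 - k) * y * (r / h)\<bar>) \<longlongrightarrow> 0) (at 0)"
        by (simp add: isCont_def)
      then have "(picard C f \<longlongrightarrow> 0) (at 0)"
        using bound by (rule_tac Lim_null_comparison[OF always_eventually]) simp_all
      with 2 show ?thesis by (simp add: isCont_def picard_def)
    qed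
  qed
  then show ?thesis by (simp add: continuous_on_eq_continuous_at)
qed

section \<open>Fixed point and return to the differential equations\<close>

text \<open>Banach's theorem on the bounded continuous functions with values in
  \<open>[0, k]\<close>: a large \<open>C\<close> makes the Picard map preserve this set and halve
  distances.\<close>

lemma fixed_point:
  obtains C f where "C \<ge> 1" "admissible f" "\<And>x. picard C f x = f x"
proof -
  have "h / r > 0" and r0: "r > 0" using h r by auto
  from powr_one_plus_le[OF r0 this(1)]
  obtain B where B: "B > 0" "\<And>s. s \<ge> 0 \<Longrightarrow> (1 + s) powr r \<le> B * (s powr r + h / r)" by blast
  define b where "b = B powr (1 - 1 / r)"
  define L where "L = K * B / (k * (r - m))"
  \<comment> \<open>The three entries ensure in turn \<open>C \<ge> 1\<close>, the self-map bound
    \<open>b / M \<le> k\<close>, and the contraction constant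
    \<open>b / M * L \<le> 1 / 2\<close>.\<close>
  define M where "M = Max {1, b / k, 2 * b * L}"
  define C where "C = M powr r"
  have b: "b > 0" and L: "L \<ge> 0"
    using B K k m by (auto simp: b_def L_def)
  have M: "M \<ge> 1" "M \<ge> b / k" "M \<ge> 2 * b * L" by (simp_all add: M_def)
  have C: "C \<ge> 1" using M r by (simp add: C_def ge_one_powr_ge_zero)
  have M': "b / M \<le> k" "b / M * L \<le> 1 / 2"
    using M k by (simp_all add: field_simps)
  have le: "picard C f x \<le> b / M" if "admissible f" for f x
  proof (cases "x > 0")
    case True
    then show ?thesis unfolding b_def C_def by (intro picard_le that M B) auto
  qed (use b M in \<open>auto simp: picard_def\<close>)
  have maps: "admissible (picard C f)" if "admissible f" for f
  proof -
    have "picard C f s \<in> {0..k}" for s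
      using picard_nonneg[OF that, of C s] le[OF that, of s] M'(1) C by simp
    then show ?thesis
      using picard_continuous[OF that] C by (simp add: admissible_def)
  qed
  have lip: "\<bar>picard C f x - picard C g x\<bar> \<le> 1 / 2 * d"
    if "admissible f" "admissible g" "\<And>s. \<bar>f s - g s\<bar> \<le> d" for f g d x
  proof (cases "x > 0")
    case True
    have d: "d \<ge> 0" using that(3)[of 0] by linarith
    have "\<bar>picard C f x - picard C g x\<bar> \<le> picard C f x * (L * d)"
      unfolding L_def by (intro picard_diff that True C B)
    also have "\<dots> \<le> b / M * (L * d)"
      using le[OF that(1)] L d by (intro mult_right_mono) auto
    also have "\<dots> \<le> 1 / 2 * d"
      using mult_right_mono[OF M'(2) d] by (simp add: mult.assoc)
    finally show ?thesis .
  next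
    case False
    then show ?thesis using that(3)[of 0] by (simp add: picard_def)
  qed
  \<comment> \<open>The admissible functions form a closed subset of the Banach space of bounded
    continuous functions, hence a complete one.\<close>
  let ?S = "PiC UNIV (\<lambda>_. {0..k}) :: (real \<Rightarrow>\<^sub>C real) set"
  have S: "p \<in> ?S \<longleftrightarrow> admissible (apply_bcontfun p)" for p
    by (auto simp: mem_PiC_iff admissible_def)
  have bc: "f \<in> bcontfun" if "admissible f" for f
    using that by (intro bcontfun_normI[of _ k]) (auto simp: admissible_def)
  define T where "T p = Bcontfun (picard C (apply_bcontfun p))" for p
  have T: "apply_bcontfun (T p) = picard C (apply_bcontfun p)" if "p \<in> ?S" for p
    unfolding T_def using that bc maps S by (simp add: Bcontfun_inverse)
  have "\<exists>!p\<in>?S. T p = p"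
  proof (rule Banach_fix)
    show "complete ?S"
      by (intro complete_eq_closed[THEN iffD2] closed_PiC) auto
    have "Bcontfun (\<lambda>_. 0) \<in> ?S"
      using k by (subst S) (simp add: admissible_def Bcontfun_inverse const_bcontfun)
    then show "?S \<noteq> {}" by blast
    show "T ` ?S \<subseteq> ?S"
      using S T maps by auto
    show "dist (T p) (T q) \<le> 1 / 2 * dist p q" if "p \<in> ?S" "q \<in> ?S" for p q
    proof (rule dist_bound)
      fix x
      have "\<bar>apply_bcontfun p s - apply_bcontfun q s\<bar> \<le> dist p q" for s
        using dist_bounded[of p s q] by (simp add: dist_real_def)
      then have "\<bar>picard C (apply_bcontfun p) x - picard C (apply_bcontfun q) x\<bar> \<le> 1 / 2 * dist p q"
        using that S by (intro lip) auto
      then show "dist (apply_bcontfun (T p) x) (apply_bcontfun (T q) x) \<le> 1 / 2 * dist p q"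
        using that T by (simp add: dist_real_def)
    qed
  qed auto
  then obtain p where p: "p \<in> ?S" "T p = p" by blast
  show thesis
    using that[OF C, of "apply_bcontfun p"] p S T by metis
qed

text \<open>In the derivative of the primitive of the fixed point, the weight
  \<open>(1 + x) powr (k - 1)\<close> cancels the factor \<open>(1 + x) powr (1 - k)\<close> built
  into the Picard map.\<close>

theorem solution:
  obtains y V where
    "continuous_on {0..} y" "y 0 = 0" "\<And>x. x \<ge> 0 \<Longrightarrow> y x \<ge> 0" "\<And>x. x > 0 \<Longrightarrow> V x > 0"
    "\<And>x. x > 0 \<Longrightarrow> (y has_real_derivative x powr (1 - r) / V x) (at x)"
    "\<And>x. x > 0 \<Longrightarrow> (V has_real_derivative - (x powr (-r - 1) * H x (y x))) (at x)"
proof -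
  obtain C f where C: "C \<ge> 1" and f: "admissible f" and fix_f: "\<And>x. picard C f x = f x"
    using fixed_point by blast
  have f': "continuous_on UNIV f" using f by (simp add: admissible_def)
  show thesis
  proof (rule that[of "weighted_primitive k f" "velocity C f"])
    show "continuous_on {0..} (weighted_primitive k f)"
      by (rule weighted_primitive_continuous[OF k(1) f'])
    show "weighted_primitive k f 0 = 0" by (simp add: weighted_primitive_def)
    show "weighted_primitive k f x \<ge> 0" if "x \<ge> 0" for x
      using primitive_bounds[OF f that] by simp
    show "velocity C f x > 0" if "x > 0" for x
      using velocity_pos[OF f that] C by simp
    show "(velocity C f has_real_derivative - (x powr (-r - 1) * H x (weighted_primitive k f x))) (at x)"
      if "x > 0" for x
      using velocity_deriv[OF f that] by (simp add: source_def)
    show "(weighted_primitive k f has_real_derivative x powr (1 - r) / velocity C f x) (at x)"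
      if "x > 0" for x
    proof -
      have "f x * (1 + x) powr (k - 1)
          = x powr (1 - r) / velocity C f x * ((1 + x) powr (1 - k) * (1 + x) powr (k - 1))"
        using that by (simp flip: fix_f add: picard_eq)
      also have "(1 + x) powr (1 - k) * (1 + x) powr (k - 1) = 1"
        using that by (simp flip: powr_add)
      finally show ?thesis
        using weighted_primitive_deriv[OF k(1) f' that] by simp
    qed
  qed
qed

text \<open>Setting \<open>Y = x powr r * V\<close> undoes the integrating factor; the product rule
  restores the linear equation that is singular at 0.\<close>

lemma rescaled_solution:
  obtains y Y where
    "continuous_on {0..} y" "y 0 = 0" "\<And>x. x \<ge> 0 \<Longrightarrow> y x \<ge> 0" "\<And>x. x > 0 \<Longrightarrow> Y x > 0"
    "\<And>x. x > 0 \<Longrightarrow> (y has_real_derivative x / Y x) (at x)"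
    "\<And>x. x > 0 \<Longrightarrow> (Y has_real_derivative (r * Y x - H x (y x)) / x) (at x)"
proof -
  obtain y V where y: "continuous_on {0..} y" "y 0 = 0" "\<And>x. x \<ge> 0 \<Longrightarrow> y x \<ge> 0"
    and V: "\<And>x. x > 0 \<Longrightarrow> V x > 0"
    and y': "\<And>x. x > 0 \<Longrightarrow> (y has_real_derivative x powr (1 - r) / V x) (at x)"
    and V': "\<And>x. x > 0 \<Longrightarrow> (V has_real_derivative - (x powr (-r - 1) * H x (y x))) (at x)"
    using solution by blast
  show thesis
  proof (rule that[OF y, of "\<lambda>x. x powr r * V x"])
    fix x :: real
    assume x: "x > 0"
    show "x powr r * V x > 0" using V[OF x] x by simp
    show "(y has_real_derivative x / (x powr r * V x)) (at x)"
      using y'[OF x] x by (simp add: powr_diff)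
    have "x powr r * x powr (-r - 1) = 1 / x"
      using x by (simp add: powr_minus_divide flip: powr_add)
    then have "x powr r * (x powr (-r - 1) * H x (y x)) = H x (y x) / x"
      by (simp only: mult.assoc[symmetric]) simp
    moreover have "x powr (r - 1) = x powr r / x"
      using x by (simp add: powr_diff)
    ultimately have eq: "r * x powr (r - 1) * V x + - (x powr (-r - 1) * H x (y x)) * x powr r
        = (r * (x powr r * V x) - H x (y x)) / x"
      using x by (simp add: diff_divide_distrib mult.commute mult.left_commute)
    show "((\<lambda>x. x powr r * V x) has_real_derivative (r * (x powr r * V x) - H x (y x)) / x) (at x)"
      using DERIV_mult[OF has_real_derivative_powr[OF x, of r] V'[OF x]] unfolding eq .
  qed
qed

end

section \<open>Reciprocal profiles for small and for large exponents\<close>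

text \<open>For \<open>n \<le> 1\<close> one has \<open>r > 2\<close>. As \<open>S\<close> stays
  above \<open>\<Sigma>\<^sub>0\<close>, the term \<open>x\<^sup>2 / S\<close> grows at most
  quadratically, hence more slowly than \<open>x powr r\<close>, and the contraction applies
  directly to \<open>y = S - \<Sigma>\<^sub>0\<close>.\<close>

lemma reciprocal_profile_exists_le:
  fixes A n \<Sigma>\<^sub>0 :: real
  assumes A: "A > 0" and n: "0 < n" "n \<le> 1" and \<Sigma>\<^sub>0: "\<Sigma>\<^sub>0 > 0"
  obtains S W where
    "continuous_on {0..} S" "S 0 = \<Sigma>\<^sub>0" "\<And>x. x \<ge> 0 \<Longrightarrow> S x > 0" "\<And>x. x > 0 \<Longrightarrow> W x > 0"
    "\<And>x. x > 0 \<Longrightarrow> (S has_real_derivative x / W x) (at x)"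
    "\<And>x. x > 0 \<Longrightarrow> (W has_real_derivative
        ((A + n + 1) / n * W x - (A * S x + x\<^sup>2 / S x) / n) / x) (at x)"
proof -
  define r where "r = (A + n + 1) / n"
  have r: "r > 2" using A n by (simp add: r_def field_simps)
  \<comment> \<open>The first two terms bound the source at \<open>y = 0\<close>, the last bracket
    its Lipschitz constant; the sum serves for both.\<close>
  define K where "K = (A * \<Sigma>\<^sub>0 + 1 / \<Sigma>\<^sub>0 + (A + 1 / \<Sigma>\<^sub>0\<^sup>2)) / n"
  have sq: "x\<^sup>2 \<le> (1 + x) powr 2" "1 \<le> (1 + x) powr 2" if "x \<ge> 0" for x :: real
    using that by (simp_all add: powr_numeral power_mono ge_one_powr_ge_zero)
  \<comment> \<open>The Lipschitz constant of the source grows like \<open>(1 + x) powr 2\<close>,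
    so \<open>m - k\<close> has to be 2. Taking \<open>k\<close> as half of the gap
    \<open>r - 2\<close> leaves \<open>m = 2 + k\<close> below \<open>r\<close>.\<close>
  interpret shear_contraction r "2 + (r - 2) / 2" "(r - 2) / 2" K "A * \<Sigma>\<^sub>0 / n"
    "\<lambda>x y. (A * (\<Sigma>\<^sub>0 + y) + x\<^sup>2 / (\<Sigma>\<^sub>0 + y)) / n"
  proof
    show "K \<ge> 0" using A n \<Sigma>\<^sub>0 by (simp add: K_def)
    show "continuous_on ({0..} \<times> {0..}) (\<lambda>(x, y). (A * (\<Sigma>\<^sub>0 + y) + x\<^sup>2 / (\<Sigma>\<^sub>0 + y)) / n)"
      unfolding case_prod_beta using n \<Sigma>\<^sub>0 by (intro continuous_intros) (auto simp: add_nonneg_eq_0_iff)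
    show "A * \<Sigma>\<^sub>0 / n \<le> (A * (\<Sigma>\<^sub>0 + y) + x\<^sup>2 / (\<Sigma>\<^sub>0 + y)) / n" if "x \<ge> 0" "y \<ge> 0" for x y
      using that A n \<Sigma>\<^sub>0 by (intro divide_right_mono) (auto simp: ring_distribs)
    show "(A * (\<Sigma>\<^sub>0 + 0) + x\<^sup>2 / (\<Sigma>\<^sub>0 + 0)) / n \<le> K * (1 + x) powr (2 + (r - 2) / 2)" if x: "x \<ge> 0" for x
    proof -
      have "A * \<Sigma>\<^sub>0 * 1 + 1 / \<Sigma>\<^sub>0 * x\<^sup>2 \<le> A * \<Sigma>\<^sub>0 * (1 + x) powr 2 + 1 / \<Sigma>\<^sub>0 * (1 + x) powr 2"
        using A \<Sigma>\<^sub>0 sq[OF x] by (intro add_mono mult_left_mono) auto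
      also have "\<dots> = (A * \<Sigma>\<^sub>0 + 1 / \<Sigma>\<^sub>0) * (1 + x) powr 2"
        by (simp add: ring_distribs)
      also have "\<dots> \<le> (A * \<Sigma>\<^sub>0 + 1 / \<Sigma>\<^sub>0 + (A + 1 / \<Sigma>\<^sub>0\<^sup>2)) * (1 + x) powr (2 + (r - 2) / 2)"
        using A \<Sigma>\<^sub>0 x r by (intro mult_mono powr_mono) auto
      finally show ?thesis
        using n by (simp add: K_def divide_right_mono)
    qed
    show "\<bar>(A * (\<Sigma>\<^sub>0 + y) + x\<^sup>2 / (\<Sigma>\<^sub>0 + y)) / n - (A * (\<Sigma>\<^sub>0 + z) + x\<^sup>2 / (\<Sigma>\<^sub>0 + z)) / n\<bar>
        \<le> K * (1 + x) powr (2 + (r - 2) / 2 - (r - 2) / 2) * \<bar>y - z\<bar>"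
      if x: "x \<ge> 0" and y: "y \<in> {0..(1 + x) powr ((r - 2) / 2)}"
        and z: "z \<in> {0..(1 + x) powr ((r - 2) / 2)}" for x y z
    proof -
      have pos: "\<Sigma>\<^sub>0 + y > 0" "\<Sigma>\<^sub>0 + z > 0" using y z \<Sigma>\<^sub>0 by auto
      \<comment> \<open>An exact factorization replaces the mean value theorem and exhibits the
        Lipschitz factor.\<close>
      have "A * a + c / a - (A * b + c / b) = (A - c / (a * b)) * (a - b)" if "a > 0" "b > 0" for a b c
        using that by (simp add: field_simps)
      from this[OF pos, of "x\<^sup>2"]
      have "A * (\<Sigma>\<^sub>0 + y) + x\<^sup>2 / (\<Sigma>\<^sub>0 + y) - (A * (\<Sigma>\<^sub>0 + z) + x\<^sup>2 / (\<Sigma>\<^sub>0 + z))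
          = (A - x\<^sup>2 / ((\<Sigma>\<^sub>0 + y) * (\<Sigma>\<^sub>0 + z))) * (y - z)"
        by simp
      moreover have "\<bar>A - x\<^sup>2 / ((\<Sigma>\<^sub>0 + y) * (\<Sigma>\<^sub>0 + z))\<bar> \<le> (n * K) * (1 + x) powr 2"
      proof -
        have "x\<^sup>2 / ((\<Sigma>\<^sub>0 + y) * (\<Sigma>\<^sub>0 + z)) \<le> (1 + x) powr 2 / (\<Sigma>\<^sub>0 * \<Sigma>\<^sub>0)"
          using sq[OF x] \<Sigma>\<^sub>0 y z by (intro frac_le mult_mono) auto
        moreover have "0 \<le> x\<^sup>2 / ((\<Sigma>\<^sub>0 + y) * (\<Sigma>\<^sub>0 + z))" using pos by simp
        moreover have "A * 1 \<le> A * (1 + x) powr 2"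
          using A sq[OF x] by (intro mult_left_mono) auto
        ultimately have "\<bar>A - x\<^sup>2 / ((\<Sigma>\<^sub>0 + y) * (\<Sigma>\<^sub>0 + z))\<bar>
            \<le> A * (1 + x) powr 2 + (1 + x) powr 2 / (\<Sigma>\<^sub>0 * \<Sigma>\<^sub>0)"
          using A by linarith
        also have "\<dots> = (A + 1 / \<Sigma>\<^sub>0\<^sup>2) * (1 + x) powr 2"
          by (simp add: distrib_right power2_eq_square)
        also have "\<dots> \<le> (n * K) * (1 + x) powr 2"
          using A \<Sigma>\<^sub>0 n by (intro mult_right_mono) (auto simp: K_def)
        finally show ?thesis .
      qed
      ultimately have "\<bar>A * (\<Sigma>\<^sub>0 + y) + x\<^sup>2 / (\<Sigma>\<^sub>0 + y) - (A * (\<Sigma>\<^sub>0 + z) + x\<^sup>2 / (\<Sigma>\<^sub>0 + z))\<bar>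
          \<le> (n * K) * (1 + x) powr 2 * \<bar>y - z\<bar>"
        by (simp add: abs_mult mult_right_mono)
      then have "\<bar>A * (\<Sigma>\<^sub>0 + y) + x\<^sup>2 / (\<Sigma>\<^sub>0 + y) - (A * (\<Sigma>\<^sub>0 + z) + x\<^sup>2 / (\<Sigma>\<^sub>0 + z))\<bar> / n
          \<le> K * (1 + x) powr 2 * \<bar>y - z\<bar>"
        using n by (simp add: divide_le_eq mult_ac)
      then show ?thesis
        using n by (simp add: diff_divide_distrib[symmetric] abs_divide)
    qed
  qed (use r A n \<Sigma>\<^sub>0 in \<open>auto simp: field_simps\<close>)
  obtain y Y where y: "continuous_on {0..} y" "y 0 = 0" "\<And>x. x \<ge> 0 \<Longrightarrow> y x \<ge> 0" "\<And>x. x > 0 \<Longrightarrow> Y x > 0"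
    "\<And>x. x > 0 \<Longrightarrow> (y has_real_derivative x / Y x) (at x)"
    "\<And>x. x > 0 \<Longrightarrow> (Y has_real_derivative
        (r * Y x - (A * (\<Sigma>\<^sub>0 + y x) + x\<^sup>2 / (\<Sigma>\<^sub>0 + y x)) / n) / x) (at x)"
    using rescaled_solution by blast
  show thesis
  proof (rule that[of "\<lambda>x. \<Sigma>\<^sub>0 + y x" Y])
    show "((\<lambda>x. \<Sigma>\<^sub>0 + y x) has_real_derivative x / Y x) (at x)" if "x > 0" for x
      using DERIV_add[OF DERIV_const y(5)[OF that]] by simp
  qed (use y \<Sigma>\<^sub>0 in \<open>auto simp: r_def intro!: continuous_intros add_pos_nonneg\<close>)
qed

text \<open>
  For \<open>n > 1\<close> the source \<open>x\<^sup>2 / S\<close> can be too large at infinity.  It disappears from the equation for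
  \<open>Y = W * S powr (1 / n)\<close>, and \<open>S powr (1 - 1 / n)\<close> then has the derivative \<open>(1 - 1 / n) * x / Y\<close>.
\<close>

lemma reciprocal_profile_exists_gt:
  fixes A n \<Sigma>\<^sub>0 :: real
  assumes A: "A > 0" and n: "n > 1" and \<Sigma>\<^sub>0: "\<Sigma>\<^sub>0 > 0"
  obtains S W where
    "continuous_on {0..} S" "S 0 = \<Sigma>\<^sub>0" "\<And>x. x \<ge> 0 \<Longrightarrow> S x > 0" "\<And>x. x > 0 \<Longrightarrow> W x > 0"
    "\<And>x. x > 0 \<Longrightarrow> (S has_real_derivative x / W x) (at x)"
    "\<And>x. x > 0 \<Longrightarrow> (W has_real_derivative
        ((A + n + 1) / n * W x - (A * S x + x\<^sup>2 / S x) / n) / x) (at x)"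
proof -
  \<comment> \<open>With \<open>Q = S powr k\<close> one has \<open>S = Q powr (1 + p)\<close> and
    \<open>S powr (1 / n) = Q powr p\<close>. The source \<open>A / n * S powr (1 + 1 / n)\<close>
    of the equation for \<open>Y\<close> becomes \<open>A / n * Q powr e\<close>, and
    \<open>Q = s + k * y\<close> with \<open>y' = x / Y\<close>. Since \<open>e * k = m\<close>, a
    \<open>Q\<close> of order \<open>(1 + x) powr k\<close> gives a source of order
    \<open>(1 + x) powr m\<close>, and \<open>m < r\<close> because \<open>A > 0\<close>.\<close>
  define r k m e p s where "r = (A + n + 1) / n" and "k = 1 - 1 / n" and "m = 1 + 1 / n"
    and "e = (n + 1) / (n - 1)" and "p = 1 / (n - 1)" and "s = \<Sigma>\<^sub>0 powr k"
  have k_eq: "k = (n - 1) / n" and e_eq: "e - 1 = 2 * p" and p_eq: "1 + p = n / (n - 1)"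
    using n by (simp_all add: k_def e_def p_def field_simps)
  have kp: "k * (1 + p) = 1" "p * k = 1 / n"
    using n by (simp_all only: k_eq p_eq) (simp_all add: p_def)
  have ke: "k * (e - 1) = m - k"
    using n unfolding e_eq by (simp add: k_eq p_def m_def) (simp add: field_simps)
  have k: "0 < k" and e: "e > 1" and ep: "e - p = 1 + p"
    using n e_eq by (simp_all add: k_eq) (smt (verit) p_def divide_pos_pos)
  have s: "s > 0" using \<Sigma>\<^sub>0 by (simp add: s_def)
  \<comment> \<open>The first term is the source at \<open>y = 0\<close>. The second bounds its
    derivative in \<open>y\<close>, by means of
    \<open>s + k * w \<le> (s + k) * (1 + x) powr k\<close> and
    \<open>k * (e - 1) = m - k\<close>.\<close>
  define K where "K = A / n * s powr e + A / n * e * (s + k) powr (e - 1) * k"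
  interpret shear_contraction r m k K "A / n * s powr e" "\<lambda>x y. A / n * (s + k * y) powr e"
  proof
    show "1 < r" "m < r" "2 - r \<le> k"
      using A n by (simp_all add: r_def m_def k_def field_simps)
    show "0 \<le> m" using n by (simp add: m_def)
    show "0 < A / n * s powr e" using A n s by simp
    show "K \<ge> 0" using A n s k e by (simp add: K_def)
    show "continuous_on ({0..} \<times> {0..}) (\<lambda>(x, y). A / n * (s + k * y) powr e)"
      unfolding case_prod_beta using n s k
      by (intro continuous_intros) (auto simp: add_pos_nonneg less_imp_neq[symmetric])
    show "A / n * s powr e \<le> A / n * (s + k * y) powr e" if "y \<ge> 0" for y
      using that A n s k e by (intro mult_left_mono powr_mono2) auto
    show "A / n * (s + k * 0) powr e \<le> K * (1 + x) powr m" if "x \<ge> 0" for x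
    proof -
      have "A / n * s powr e * 1 \<le> K * (1 + x) powr m"
        using that A n s k e by (intro mult_mono ge_one_powr_ge_zero) (auto simp: K_def m_def)
      then show ?thesis by simp
    qed
    show "\<bar>A / n * (s + k * y) powr e - A / n * (s + k * z) powr e\<bar> \<le> K * (1 + x) powr (m - k) * \<bar>y - z\<bar>"
      if x: "x \<ge> 0" and y: "y \<in> {0..(1 + x) powr k}" and z: "z \<in> {0..(1 + x) powr k}" for x y z
    proof -
      have "norm (A / n * (s + k * y) powr e - A / n * (s + k * z) powr e)
          \<le> K * (1 + x) powr (m - k) * norm (y - z)"
      proof (rule field_differentiable_bound[OF _ _ _ y z])
        fix w
        assume w: "w \<in> {0..(1 + x) powr k}"
        have q: "s + k * w > 0" using w s k by (simp add: add_pos_nonneg)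
        show "((\<lambda>y. A / n * (s + k * y) powr e) has_field_derivative
            A / n * (e * (s + k * w) powr (e - 1) * k)) (at w within {0..(1 + x) powr k})"
          using q n by (auto intro!: derivative_eq_intros)
        have "s * 1 + k * w \<le> s * (1 + x) powr k + k * (1 + x) powr k"
          using w s k x by (intro add_mono mult_left_mono ge_one_powr_ge_zero) auto
        then have "(s + k * w) powr (e - 1) \<le> ((s + k) * (1 + x) powr k) powr (e - 1)"
          using q e by (intro powr_mono2) (auto simp: ring_distribs)
        also have "\<dots> = (s + k) powr (e - 1) * (1 + x) powr (m - k)"
          using s k by (simp add: powr_mult powr_powr ke)
        finally have "A / n * e * k * (s + k * w) powr (e - 1)
            \<le> A / n * e * k * ((s + k) powr (e - 1) * (1 + x) powr (m - k))"
          using A n e k by (intro mult_left_mono) auto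
        also have "\<dots> \<le> K * (1 + x) powr (m - k)"
          using A n by (simp add: K_def ring_distribs mult_ac)
        finally show "norm (A / n * (e * (s + k * w) powr (e - 1) * k)) \<le> K * (1 + x) powr (m - k)"
          using A n e k by (simp add: abs_mult mult_ac)
      qed auto
      then show ?thesis by simp
    qed
  qed (use k in auto)
  obtain y Y where y: "continuous_on {0..} y" "y 0 = 0" "\<And>x. x \<ge> 0 \<Longrightarrow> y x \<ge> 0"
    and Y: "\<And>x. x > 0 \<Longrightarrow> Y x > 0"
    and y': "\<And>x. x > 0 \<Longrightarrow> (y has_real_derivative x / Y x) (at x)"
    and Y': "\<And>x. x > 0 \<Longrightarrow> (Y has_real_derivative (r * Y x - A / n * (s + k * y x) powr e) / x) (at x)"
    using rescaled_solution by blast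
  have q: "s + k * y x > 0" if "x \<ge> 0" for x
    using y(3)[OF that] s k by (simp add: add_pos_nonneg)
  show thesis
  proof (rule that[of "\<lambda>x. (s + k * y x) powr (1 + p)" "\<lambda>x. Y x * (s + k * y x) powr (-p)"])
    show "continuous_on {0..} (\<lambda>x. (s + k * y x) powr (1 + p))"
      using q y(1) by (intro continuous_intros) (auto simp: less_imp_neq[symmetric])
    show "(s + k * y 0) powr (1 + p) = \<Sigma>\<^sub>0"
      using \<Sigma>\<^sub>0 y(2) kp by (simp add: s_def powr_powr)
    show "(s + k * y x) powr (1 + p) > 0" if "x \<ge> 0" for x
      using q[OF that] by simp
    fix x :: real
    assume x: "x > 0"
    define Q where "Q = s + k * y x"
    have Q: "Q > 0" using q[of x] x by (simp add: Q_def)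
    have q': "((\<lambda>x. s + k * y x) has_real_derivative k * (x / Y x)) (at x)"
      using DERIV_add[OF DERIV_const DERIV_cmult[OF y'[OF x], of k]] by simp
    have pow: "((\<lambda>x. (s + k * y x) powr a) has_real_derivative a * Q powr (a - 1) * (k * (x / Y x))) (at x)" for a
      using DERIV_chain2[OF has_real_derivative_powr q', of a] Q by (simp add: Q_def)
    show "Y x * (s + k * y x) powr (-p) > 0" using Y[OF x] Q by (simp add: Q_def)
    have "(1 + p) * Q powr (1 + p - 1) * (k * (x / Y x)) = (k * (1 + p)) * (x / (Y x * Q powr (-p)))"
      using Q by (simp add: powr_minus field_simps)
    with pow[of "1 + p"] kp
    show "((\<lambda>x. (s + k * y x) powr (1 + p)) has_real_derivative x / (Y x * (s + k * y x) powr (-p))) (at x)"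
      by (simp add: Q_def)
    \<comment> \<open>The product rule for \<open>Y * Q powr (-p)\<close>: differentiating the
      second factor brings back the term \<open>x\<^sup>2 / S / n\<close> that the substitution had
      removed, because \<open>p * k = 1 / n\<close>.\<close>
    have "(r * Y x - A / n * Q powr e) / x * Q powr (-p) + (-p) * Q powr (-p - 1) * (k * (x / Y x)) * Y x
        = (r * (Y x * Q powr (-p)) - (A * Q powr (1 + p) + x\<^sup>2 / Q powr (1 + p)) / n) / x"
    proof -
      have 1: "Q powr e * Q powr (-p) = Q powr (1 + p)"
        using powr_add[of Q e "-p"] ep by simp
      have 2: "Q powr (-p - 1) = 1 / Q powr (1 + p)"
        using powr_minus_divide[of Q "1 + p"] by (simp add: minus_diff_commute)
      have 3: "(r * Y x - A / n * Q powr e) / x * Q powr (-p)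
          = (r * (Y x * Q powr (-p)) - A / n * (Q powr e * Q powr (-p))) / x"
        by (simp add: right_diff_distrib mult_ac)
      have "(-p) * Q powr (-p - 1) * (k * (x / Y x)) * Y x = - (p * k) * x / Q powr (1 + p)"
        using Y[OF x] by (simp add: 2)
      also have "\<dots> = - (x\<^sup>2 / Q powr (1 + p) / n) / x"
        using x n by (simp add: kp power2_eq_square)
      finally have 4: "(-p) * Q powr (-p - 1) * (k * (x / Y x)) * Y x = - (x\<^sup>2 / Q powr (1 + p) / n) / x" .
      show ?thesis
        unfolding 3 4 1 by (simp add: diff_divide_distrib add_divide_distrib)
    qed
    then show "((\<lambda>x. Y x * (s + k * y x) powr (-p)) has_real_derivative
        ((A + n + 1) / n * (Y x * (s + k * y x) powr (-p)) -
          (A * (s + k * y x) powr (1 + p) + x\<^sup>2 / (s + k * y x) powr (1 + p)) / n) / x) (at x)"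
      using DERIV_mult[OF Y'[OF x] pow[of "-p"]] by (simp add: Q_def r_def)
  qed
qed

lemma reciprocal_profile_exists:
  fixes A n \<Sigma>\<^sub>0 :: real
  assumes A: "A > 0" and n: "n > 0" and \<Sigma>\<^sub>0: "\<Sigma>\<^sub>0 > 0"
  obtains S W where
    "continuous_on {0..} S" "S 0 = \<Sigma>\<^sub>0" "\<And>x. x \<ge> 0 \<Longrightarrow> S x > 0" "\<And>x. x > 0 \<Longrightarrow> W x > 0"
    "\<And>x. x > 0 \<Longrightarrow> (S has_real_derivative x / W x) (at x)"
    "\<And>x. x > 0 \<Longrightarrow> (W has_real_derivative
        ((A + n + 1) / n * W x - (A * S x + x\<^sup>2 / S x) / n) / x) (at x)"
  using reciprocal_profile_exists_le[OF A n _ \<Sigma>\<^sub>0] reciprocal_profile_exists_gt[OF A _ \<Sigma>\<^sub>0]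
  by (metis not_le)

section \<open>Behaviour at the origin and even extension\<close>

lemma filterlim_abs_at_right_0: "filterlim (\<lambda>x::real. \<bar>x\<bar>) (at_right 0) (at 0)"
proof -
  have "((\<lambda>x::real. \<bar>x\<bar>) \<longlongrightarrow> 0) (at 0)"
    by (rule tendsto_rabs_zero) (rule tendsto_ident_at)
  moreover have "eventually (\<lambda>x::real. \<bar>x\<bar> \<in> {0<..}) (at 0)"
    by (auto simp: eventually_at intro: exI[of _ 1])
  ultimately show ?thesis
    by (simp add: filterlim_at eventually_at_filter)
qed

text \<open>The value at 0 is a separate argument, since the profiles are controlled only on the
  open half-line; it will be the limit from the right.\<close>

definition even_extension :: "real \<Rightarrow> (real \<Rightarrow> real) \<Rightarrow> real \<Rightarrow> real" where
  "even_extension c f x = (if x = 0 then c else f \<bar>x\<bar>)"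

text \<open>Serves as the derivative of an even extension; \<open>sgn 0 = 0\<close> supplies the
  derivative at the origin.\<close>

definition odd_extension :: "(real \<Rightarrow> real) \<Rightarrow> real \<Rightarrow> real" where
  "odd_extension f x = sgn x * f \<bar>x\<bar>"

lemma even_extension_even: "even_extension c f (- x) = even_extension c f x"
  by (simp add: even_extension_def)

lemma odd_extension_0 [simp]: "odd_extension f 0 = 0"
  by (simp add: odd_extension_def)

context
  fixes f f' :: "real \<Rightarrow> real" and c :: real
  assumes f: "\<And>x. x > 0 \<Longrightarrow> (f has_real_derivative f' x) (at x)"
    and f_lim: "(f \<longlongrightarrow> c) (at_right 0)" and f'_lim: "(f' \<longlongrightarrow> 0) (at_right 0)"
begin

text \<open>Away from 0 this is the chain rule. At 0, L'Hopital's rule sends the right difference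
  quotient to the limit of \<open>f'\<close>, which is 0; the modulus of the difference quotient is
  even, so the one-sided limit settles both sides.\<close>

lemma even_extension_deriv:
  "(even_extension c f has_real_derivative odd_extension f' x) (at x)"
proof -
  consider "x > 0" | "x < 0" | "x = 0" by linarith
  then show ?thesis
  proof cases
    case 1
    have "(even_extension c f has_real_derivative f' x) (at x)"
      by (rule has_field_derivative_transform_within_open[OF f[OF 1] open_greaterThan[of 0]])
        (use 1 in \<open>auto simp: even_extension_def\<close>)
    with 1 show ?thesis by (simp add: odd_extension_def)
  next
    case 2
    have *: "((\<lambda>y. f (- y)) has_real_derivative f' (- x) * (- 1)) (at x)"
      by (rule DERIV_chain2[of f]) (use 2 f[of "- x"] in \<open>auto intro!: derivative_eq_intros\<close>)
    have "(even_extension c f has_real_derivative f' (- x) * (- 1)) (at x)"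
      by (rule has_field_derivative_transform_within_open[OF * open_lessThan[of 0]])
        (use 2 in \<open>auto simp: even_extension_def\<close>)
    with 2 show ?thesis by (simp add: odd_extension_def)
  next
    case 3
    have "((\<lambda>x. (f x - c) / x) \<longlongrightarrow> 0) (at_right 0)"
    proof (rule lhopital_right_0)
      show "((\<lambda>x. f x - c) \<longlongrightarrow> 0) (at_right 0)"
        using tendsto_diff[OF f_lim tendsto_const[of c]] by simp
      show "\<forall>\<^sub>F x in at_right 0. ((\<lambda>x. f x - c) has_real_derivative f' x) (at x)"
        using eventually_at_right_less[of 0]
      proof eventually_elim
        case (elim x)
        show ?case using DERIV_diff[OF f[OF elim] DERIV_const[of c]] by simp
      qed
      show "((\<lambda>x. f' x / 1) \<longlongrightarrow> 0) (at_right 0)" using f'_lim by simp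
      show "\<forall>\<^sub>F x::real in at_right 0. x \<noteq> 0" by (auto simp: eventually_at_filter)
    qed (auto intro!: tendsto_eq_intros)
    from filterlim_compose[OF this filterlim_abs_at_right_0]
    have "((\<lambda>y. \<bar>(f \<bar>y\<bar> - c) / \<bar>y\<bar>\<bar>) \<longlongrightarrow> 0) (at 0)"
      by (rule tendsto_rabs_zero)
    moreover have "\<forall>\<^sub>F y in at 0. \<bar>(f \<bar>y\<bar> - c) / \<bar>y\<bar>\<bar>
        = \<bar>(even_extension c f (0 + y) - even_extension c f 0) / y\<bar>"
      by (auto simp: eventually_at_filter even_extension_def)
    ultimately have "((\<lambda>y. \<bar>(even_extension c f (0 + y) - even_extension c f 0) / y\<bar>) \<longlongrightarrow> 0) (at 0)"
      by (rule Lim_transform_eventually)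
    with 3 show ?thesis
      by (simp add: DERIV_def tendsto_rabs_zero_cancel flip: abs_divide)
  qed
qed

lemma odd_extension_continuous:
  assumes "continuous_on {0<..} f'"
  shows "continuous_on UNIV (odd_extension f')"
proof -
  have c: "isCont f' x" if "x > 0" for x
    using assms that by (simp add: continuous_on_eq_continuous_at)
  have "isCont (odd_extension f') x" for x
  proof (cases "x = 0")
    case True
    have "((\<lambda>y. \<bar>f' \<bar>y\<bar>\<bar>) \<longlongrightarrow> 0) (at 0)"
      by (rule tendsto_rabs_zero[OF filterlim_compose[OF f'_lim filterlim_abs_at_right_0]])
    moreover have "\<forall>\<^sub>F y in at 0. \<bar>f' \<bar>y\<bar>\<bar> = \<bar>odd_extension f' y\<bar>"
      by (auto simp: eventually_at_filter odd_extension_def abs_mult)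
    ultimately have "((\<lambda>y. \<bar>odd_extension f' y\<bar>) \<longlongrightarrow> 0) (at 0)"
      by (rule Lim_transform_eventually)
    with True show ?thesis
      by (simp add: isCont_def tendsto_rabs_zero_iff)
  next
    case False
    have "isCont (\<lambda>y. f' \<bar>y\<bar>) x"
      using False c[of "\<bar>x\<bar>"] by (intro isCont_o2[of _ abs f']) auto
    moreover have "isCont sgn x"
      using False by (intro continuous_intros) auto
    ultimately show ?thesis
      unfolding odd_extension_def by (rule continuous_mult[rotated])
  qed
  then show ?thesis by (simp add: continuous_on_eq_continuous_at)
qed

end

section \<open>Limits of the profile at the singular point\<close>

lemma filterlim_powr_at_right_0:
  fixes a :: real
  assumes "a < 0"
  shows "LIM x at_right 0. x powr a :> at_top"
proof -
  have "LIM x at_right (0::real). - ln x :> at_top"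
    using ln_at_0 by (simp add: filterlim_uminus_at_top)
  then have "LIM x at_right (0::real). exp (- a * - ln x) :> at_top"
    using assms
    by (intro filterlim_compose[OF exp_at_top] filterlim_tendsto_pos_mult_at_top[OF tendsto_const]) auto
  moreover have "\<forall>\<^sub>F x in at_right (0::real). exp (- a * - ln x) = x powr a"
    using eventually_at_right_less[of 0] by eventually_elim (simp add: powr_def)
  ultimately show ?thesis
    using filterlim_cong[OF refl refl] by fast
qed

text \<open>Both limits follow from L'Hopital's rule with a denominator tending to infinity, which
  requires no knowledge of the numerator's limit. Multiplying by \<open>x powr (-r)\<close> removes
  the linear term from the derivative of \<open>W\<close>, so only the source \<open>h\<close>
  remains. The limits are thus the same for every positive solution.\<close>

lemma reciprocal_profile_at_0:
  fixes A n r \<Sigma>\<^sub>0 :: real and S W :: "real \<Rightarrow> real"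
  assumes A: "A > 0" and n: "n > 0" and \<Sigma>\<^sub>0: "\<Sigma>\<^sub>0 > 0" and r: "r = (A + n + 1) / n"
    and S_lim: "(S \<longlongrightarrow> \<Sigma>\<^sub>0) (at_right 0)"
    and S_pos: "\<And>x. x > 0 \<Longrightarrow> S x > 0" and W_pos: "\<And>x. x > 0 \<Longrightarrow> W x > 0"
    and S': "\<And>x. x > 0 \<Longrightarrow> (S has_real_derivative x / W x) (at x)"
    and W': "\<And>x. x > 0 \<Longrightarrow> (W has_real_derivative (r * W x - (A * S x + x\<^sup>2 / S x) / n) / x) (at x)"
  shows "(W \<longlongrightarrow> A * \<Sigma>\<^sub>0 / (n * r)) (at_right 0)"
    and "((\<lambda>x. (r * W x - (A * S x + x\<^sup>2 / S x) / n) / x) \<longlongrightarrow> 0) (at_right 0)"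
proof -
  have r1: "r > 1" using A n by (simp add: r field_simps)
  have pos: "\<forall>\<^sub>F x in at_right 0. x > (0::real)" by (rule eventually_at_right_less)
  define h where "h x = (A * S x + x\<^sup>2 / S x) / n" for x
  define h' where "h' x = (A * (x / W x) + (2 * x * S x - x\<^sup>2 * (x / W x)) / (S x)\<^sup>2) / n" for x
  have W'': "(W has_real_derivative (r * W x - h x) / x) (at x)" if "x > 0" for x
    using W'[OF that] by (simp add: h_def)
  have h_lim: "(h \<longlongrightarrow> (A * \<Sigma>\<^sub>0 + 0\<^sup>2 / \<Sigma>\<^sub>0) / n) (at_right 0)"
    unfolding h_def using \<Sigma>\<^sub>0 n by (intro tendsto_intros S_lim) auto
  have powr': "((\<lambda>x. x powr a) has_real_derivative a * x powr (a - 1)) (at x)" if "x > 0" for a x :: real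
    using that by (rule has_real_derivative_powr)
  have "((\<lambda>x. (W x * x powr (-r)) / x powr (-r)) \<longlongrightarrow> A * \<Sigma>\<^sub>0 / (n * r)) (at_right 0)"
  proof (rule lhopital_right_0_at_top)
    show "LIM x at_right 0. x powr (-r) :> at_top" using r1 by (intro filterlim_powr_at_right_0) simp
    show "\<forall>\<^sub>F x in at_right 0. - r * x powr (- r - 1) \<noteq> 0"
      using pos by eventually_elim (use r1 in auto)
    show "\<forall>\<^sub>F x in at_right 0. ((\<lambda>x. x powr - r) has_real_derivative - r * x powr (- r - 1)) (at x)"
      using pos by eventually_elim (rule powr')
    show "\<forall>\<^sub>F x in at_right 0. ((\<lambda>x. W x * x powr - r) has_real_derivative - h x * x powr (- r - 1)) (at x)"
      using pos
    proof eventually_elim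
      case (elim x)
      have "(r * W x - h x) / x * x powr (-r) + (- r * x powr (- r - 1)) * W x = - h x * x powr (- r - 1)"
        using elim by (simp add: powr_diff diff_divide_distrib left_diff_distrib)
      with DERIV_mult[OF W''[OF elim] powr'[OF elim, of "-r"]] show ?case by simp
    qed
    have "((\<lambda>x. h x / r) \<longlongrightarrow> (A * \<Sigma>\<^sub>0 + 0\<^sup>2 / \<Sigma>\<^sub>0) / n / r) (at_right 0)"
      using r1 by (intro tendsto_intros h_lim) auto
    then have "((\<lambda>x. h x / r) \<longlongrightarrow> A * \<Sigma>\<^sub>0 / (n * r)) (at_right 0)" by simp
    moreover have "\<forall>\<^sub>F x in at_right 0. h x / r = - h x * x powr (- r - 1) / (- r * x powr (- r - 1))"
      using pos by eventually_elim (use r1 in auto)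
    ultimately show "((\<lambda>x. - h x * x powr (- r - 1) / (- r * x powr (- r - 1))) \<longlongrightarrow> A * \<Sigma>\<^sub>0 / (n * r)) (at_right 0)"
      by (rule Lim_transform_eventually)
  qed
  moreover have "\<forall>\<^sub>F x in at_right 0. (W x * x powr (-r)) / x powr (-r) = W x"
    using pos by eventually_elim auto
  ultimately show W_lim: "(W \<longlongrightarrow> A * \<Sigma>\<^sub>0 / (n * r)) (at_right 0)"
    by (rule Lim_transform_eventually)
  have "A * \<Sigma>\<^sub>0 / (n * r) \<noteq> 0" using A n \<Sigma>\<^sub>0 r1 by auto
  then have "(h' \<longlongrightarrow> (A * (0 / (A * \<Sigma>\<^sub>0 / (n * r))) + (2 * 0 * \<Sigma>\<^sub>0 - 0\<^sup>2 * (0 / (A * \<Sigma>\<^sub>0 / (n * r)))) / \<Sigma>\<^sub>0\<^sup>2) / n) (at_right 0)"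
    unfolding h'_def using \<Sigma>\<^sub>0 n by (intro tendsto_intros S_lim W_lim) auto
  then have h'_lim: "(h' \<longlongrightarrow> 0) (at_right 0)" by simp
  have h': "(h has_real_derivative h' x) (at x)" if "x > 0" for x
    unfolding h_def h'_def using S_pos[OF that] n
    by (auto intro!: derivative_eq_intros S'[OF that] simp: power2_eq_square)
  \<comment> \<open>This quotient is the derivative of \<open>W\<close>. Differentiating its
    numerator leaves only \<open>- h' x * x powr (-r)\<close>, so the quotient of the derivatives is
    \<open>h' x / (r - 1)\<close>, which tends to 0.\<close>
  have "((\<lambda>x. ((r * W x - h x) * x powr (-r)) / x powr (1 - r)) \<longlongrightarrow> 0) (at_right 0)"
  proof (rule lhopital_right_0_at_top)
    show "LIM x at_right 0. x powr (1 - r) :> at_top" using r1 by (intro filterlim_powr_at_right_0) simp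
    show "\<forall>\<^sub>F x in at_right 0. (1 - r) * x powr (1 - r - 1) \<noteq> 0"
      using pos by eventually_elim (use r1 in auto)
    show "\<forall>\<^sub>F x in at_right 0. ((\<lambda>x. x powr (1 - r)) has_real_derivative (1 - r) * x powr (1 - r - 1)) (at x)"
      using pos by eventually_elim (rule powr')
    show "\<forall>\<^sub>F x in at_right 0. ((\<lambda>x. (r * W x - h x) * x powr - r) has_real_derivative - h' x * x powr (- r)) (at x)"
      using pos
    proof eventually_elim
      case (elim x)
      have "(r * ((r * W x - h x) / x) - h' x) * x powr (-r) + (- r * x powr (- r - 1)) * (r * W x - h x)
          = - h' x * x powr (- r)"
        using elim by (simp add: powr_diff left_diff_distrib)
      with DERIV_mult[OF DERIV_diff[OF DERIV_cmult[OF W''[OF elim], of r] h'[OF elim]] powr'[OF elim, of "-r"]]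
      show ?case by simp
    qed
    have "((\<lambda>x. h' x / (r - 1)) \<longlongrightarrow> 0 / (r - 1)) (at_right 0)"
      using r1 by (intro tendsto_intros h'_lim) auto
    then have "((\<lambda>x. h' x / (r - 1)) \<longlongrightarrow> 0) (at_right 0)" by simp
    moreover have "\<forall>\<^sub>F x in at_right 0. h' x / (r - 1) = - h' x * x powr (- r) / ((1 - r) * x powr (1 - r - 1))"
      using pos by eventually_elim (use r1 in \<open>auto simp: field_simps\<close>)
    ultimately show "((\<lambda>x. - h' x * x powr (- r) / ((1 - r) * x powr (1 - r - 1))) \<longlongrightarrow> 0) (at_right 0)"
      by (rule Lim_transform_eventually)
  qed
  moreover have "\<forall>\<^sub>F x in at_right 0. ((r * W x - h x) * x powr (-r)) / x powr (1 - r)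
      = (r * W x - (A * S x + x\<^sup>2 / S x) / n) / x"
    using pos by eventually_elim (simp add: h_def powr_diff powr_minus field_simps)
  ultimately show "((\<lambda>x. (r * W x - (A * S x + x\<^sup>2 / S x) / n) / x) \<longlongrightarrow> 0) (at_right 0)"
    by (rule Lim_transform_eventually)
qed

section \<open>The smooth even profile on the whole line\<close>

text \<open>\<open>V\<close> and \<open>\<Sigma>\<close> are the even extensions of \<open>W\<close>
  and \<open>S\<close>. The profile equations are invariant under reflection, so they hold on the
  whole line with two-sided derivatives, the origin included.\<close>

lemma smooth_even_profile_exists:
  fixes \<alpha> n lam \<Sigma>\<^sub>0 :: real
  assumes \<alpha>: "\<alpha> > 0" and n: "n > 0" and lam: "lam > 0" and \<Sigma>\<^sub>0: "\<Sigma>\<^sub>0 > 0"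
  obtains U \<Sigma> \<Theta> U' \<Theta>' :: "real \<Rightarrow> real" where
    "even_function U" "even_function \<Sigma>" "even_function \<Theta>"
    "\<And>x. U x > 0" "\<Sigma> 0 = \<Sigma>\<^sub>0"
    "\<And>x. (U has_real_derivative U' x) (at x)"
    "\<And>x. (\<Sigma> has_real_derivative x * U x) (at x)"
    "\<And>x. (\<Theta> has_real_derivative \<Theta>' x) (at x)"
    "continuous_on UNIV U'" "continuous_on UNIV \<Theta>'"
    "\<And>x. lam * ((n + 1) / \<alpha> + x * \<Theta>' x) = \<Sigma> x * U x - 1"
    "\<And>x. \<Sigma> x = exp (- \<alpha> * \<Theta> x) * U x powr n"
proof -
  define A r where "A = \<alpha> / lam" and "r = (A + n + 1) / n"
  have A: "A > 0" using \<alpha> lam by (simp add: A_def)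
  have r: "r > 0" using A n by (simp add: r_def)
  obtain S W where S_cont: "continuous_on {0..} S" and S_0: "S 0 = \<Sigma>\<^sub>0"
    and S_pos: "\<And>x. x \<ge> 0 \<Longrightarrow> S x > 0" and W_pos: "\<And>x. x > 0 \<Longrightarrow> W x > 0"
    and S': "\<And>x. x > 0 \<Longrightarrow> (S has_real_derivative x / W x) (at x)"
    and W'': "\<And>x. x > 0 \<Longrightarrow> (W has_real_derivative
        ((A + n + 1) / n * W x - (A * S x + x\<^sup>2 / S x) / n) / x) (at x)"
    using reciprocal_profile_exists[OF A n \<Sigma>\<^sub>0] by blast
  define w where "w x = (r * W x - (A * S x + x\<^sup>2 / S x) / n) / x" for x
  have W': "\<And>x. x > 0 \<Longrightarrow> (W has_real_derivative w x) (at x)"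
    using W'' by (simp add: w_def r_def)
  define W0 where "W0 = A * \<Sigma>\<^sub>0 / (n * r)"
  have W0: "W0 > 0" using A \<Sigma>\<^sub>0 n r by (simp add: W0_def)
  have "(S \<longlongrightarrow> S 0) (at 0 within {0..})"
    using S_cont by (simp add: continuous_on_def)
  then have S_lim: "(S \<longlongrightarrow> \<Sigma>\<^sub>0) (at_right 0)"
    unfolding S_0 by (rule tendsto_within_subset) auto
  note lims = reciprocal_profile_at_0[OF A n \<Sigma>\<^sub>0 r_def S_lim S_pos[OF less_imp_le] W_pos S' W'[unfolded w_def]]
  have W_lim: "(W \<longlongrightarrow> W0) (at_right 0)" using lims(1) by (simp add: W0_def)
  have w_lim: "(w \<longlongrightarrow> 0) (at_right 0)" using lims(2) by (simp add: w_def[abs_def])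
  have "((\<lambda>x. x / W x) \<longlongrightarrow> 0 / W0) (at_right 0)"
    using W0 by (intro tendsto_intros W_lim) auto
  then have xW_lim: "((\<lambda>x. x / W x) \<longlongrightarrow> 0) (at_right 0)" by simp
  have cont_pos: "continuous_on {0<..} f" if "\<And>x. x > 0 \<Longrightarrow> (f has_real_derivative f' x) (at x)" for f f' :: "real \<Rightarrow> real"
    using that by (intro continuous_at_imp_continuous_on ballI) (auto intro: DERIV_isCont)
  have w_cont: "continuous_on {0<..} w"
    unfolding w_def using S_pos[OF less_imp_le] n
    by (intro continuous_intros cont_pos[OF S'] cont_pos[OF W']) (auto simp: less_imp_neq[symmetric])

  define V V' \<Sigma> where "V = even_extension W0 W" and "V' = odd_extension w" and "\<Sigma> = even_extension \<Sigma>\<^sub>0 S"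
  have V_deriv: "(V has_real_derivative V' x) (at x)" for x
    unfolding V_def V'_def by (rule even_extension_deriv[OF W' W_lim w_lim])
  have V'_cont: "continuous_on UNIV V'"
    unfolding V'_def by (rule odd_extension_continuous[OF W' W_lim w_lim w_cont])
  have V_pos: "V x > 0" for x
    using W_pos[of "\<bar>x\<bar>"] W0 by (simp add: V_def even_extension_def)
  have \<Sigma>_pos: "\<Sigma> x > 0" for x
    using S_pos[of "\<bar>x\<bar>"] \<Sigma>\<^sub>0 by (simp add: \<Sigma>_def even_extension_def)
  have "odd_extension (\<lambda>x. x / W x) x = x / V x" for x
    by (simp add: odd_extension_def V_def even_extension_def sgn_mult_abs flip: times_divide_eq_right)
      (simp add: mult_sgn_abs)
  then have \<Sigma>_deriv: "(\<Sigma> has_real_derivative x / V x) (at x)" for x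
    using even_extension_deriv[OF S' S_lim xW_lim, of x] by (simp add: \<Sigma>_def)
  \<comment> \<open>At 0 the left side vanishes, and the equation reduces to
    \<open>r * W0 = A * \<Sigma>\<^sub>0 / n\<close>, which is the value of
    \<open>W0\<close>.\<close>
  have ode: "x * V' x = r * V x - (A * \<Sigma> x + x\<^sup>2 / \<Sigma> x) / n" for x
  proof (cases "x = 0")
    case True
    then show ?thesis
      using r n by (simp add: V'_def V_def \<Sigma>_def even_extension_def W0_def)
  next
    case False
    have "x * V' x = \<bar>x\<bar> * w \<bar>x\<bar>"
      by (simp add: V'_def odd_extension_def mult.assoc[symmetric] mult_sgn_abs)
        (simp add: abs_sgn)
    with False show ?thesis
      by (simp add: w_def V_def \<Sigma>_def even_extension_def)
  qed

  define U U' where "U x = 1 / V x" and "U' x = - V' x / (V x)\<^sup>2" for x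
  \<comment> \<open>The constitutive law
    \<open>\<Sigma> = exp (- \<alpha> * \<Theta>) * U powr n\<close> solved for
    \<open>\<Theta>\<close>.\<close>
  define \<Theta> where "\<Theta> x = (n * ln (U x) - ln (\<Sigma> x)) / \<alpha>" for x
  define \<Theta>' where "\<Theta>' x = (n * (- V' x / V x) - x / V x / \<Sigma> x) / \<alpha>" for x
  have U_pos: "U x > 0" for x using V_pos[of x] by (simp add: U_def)
  have cont: "continuous_on UNIV f" if "\<And>x. (f has_real_derivative f' x) (at x)" for f f' :: "real \<Rightarrow> real"
    using that by (intro continuous_at_imp_continuous_on ballI) (auto intro: DERIV_isCont)
  note conts = cont[OF V_deriv] cont[OF \<Sigma>_deriv] V'_cont
  have nz: "V x \<noteq> 0" "\<Sigma> x \<noteq> 0" for x using V_pos[of x] \<Sigma>_pos[of x] by auto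
  show thesis
  proof (rule that[of U \<Sigma> \<Theta> U' \<Theta>'])
    show "even_function U" "even_function \<Sigma>" "even_function \<Theta>"
      by (simp_all add: even_function_def U_def \<Theta>_def V_def \<Sigma>_def even_extension_even)
    show "\<Sigma> 0 = \<Sigma>\<^sub>0" by (simp add: \<Sigma>_def even_extension_def)
    show "continuous_on UNIV U'" "continuous_on UNIV \<Theta>'"
      unfolding U'_def \<Theta>'_def using nz \<alpha> by (auto intro!: continuous_intros conts)
    fix x
    show "U x > 0" by (rule U_pos)
    show "(U has_real_derivative U' x) (at x)"
      unfolding U_def U'_def using nz
      by (auto intro!: derivative_eq_intros V_deriv simp: power2_eq_square)
    show "(\<Sigma> has_real_derivative x * U x) (at x)"
      using \<Sigma>_deriv[of x] by (simp add: U_def)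
    have "\<Theta> = (\<lambda>x. (n * (- ln (V x)) - ln (\<Sigma> x)) / \<alpha>)"
      using V_pos by (simp add: \<Theta>_def U_def ln_div fun_eq_iff)
    moreover have "((\<lambda>x. (n * (- ln (V x)) - ln (\<Sigma> x)) / \<alpha>) has_real_derivative \<Theta>' x) (at x)"
      unfolding \<Theta>'_def using V_pos[of x] \<Sigma>_pos[of x] \<alpha>
      by (auto intro!: derivative_eq_intros V_deriv \<Sigma>_deriv simp: mult.commute)
    ultimately show "(\<Theta> has_real_derivative \<Theta>' x) (at x)" by simp
    have "\<alpha> * \<Theta>' x = n * (- V' x / V x) - x / V x / \<Sigma> x"
      using \<alpha> by (simp add: \<Theta>'_def)
    then have "\<alpha> * (x * \<Theta>' x) = x * (n * (- V' x / V x) - x / V x / \<Sigma> x)"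
      by (simp only: mult.left_commute[of \<alpha> x])
    also have "\<dots> = - n * (x * V' x) / V x - x\<^sup>2 / (V x * \<Sigma> x)"
      by (simp add: power2_eq_square right_diff_distrib mult.left_commute)
    \<comment> \<open>Inserting the equation for \<open>V\<close> produces a term
      \<open>x\<^sup>2 / (V x * \<Sigma> x)\<close> that cancels the one coming from the derivative
      of \<open>ln (\<Sigma> x)\<close>.\<close>
    also have "\<dots> = - n * r + A * \<Sigma> x / V x"
      unfolding ode using n nz[of x] by (simp add: field_simps)
    also have "\<dots> = A * (\<Sigma> x * U x - 1) - (n + 1)"
    proof -
      have "n * r = A + n + 1" using n by (simp add: r_def)
      then show ?thesis by (simp add: U_def algebra_simps)
    qed
    finally have "\<alpha> * ((n + 1) / \<alpha> + x * \<Theta>' x) = A * (\<Sigma> x * U x - 1)"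
      unfolding distrib_left[of \<alpha>] using \<alpha> by simp
    then show "lam * ((n + 1) / \<alpha> + x * \<Theta>' x) = \<Sigma> x * U x - 1"
      using \<alpha> lam by (simp add: A_def divide_simps) (simp add: mult.commute)
    have "exp (- \<alpha> * \<Theta> x) * U x powr n = exp (- (n * ln (U x) - ln (\<Sigma> x))) * exp (n * ln (U x))"
      using \<alpha> U_pos[of x] by (simp add: \<Theta>_def powr_def)
    also have "\<dots> = \<Sigma> x"
      using \<Sigma>_pos[of x] by (simp flip: exp_add)
    finally show "\<Sigma> x = exp (- \<alpha> * \<Theta> x) * U x powr n" by simp
  qed
qed

section \<open>Localizing solutions\<close>

lemma continuous_on_apply2:
  fixes f :: "real \<Rightarrow> real"
  assumes "continuous_on UNIV f" "continuous_on S g"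
  shows "continuous_on S (\<lambda>z. f (g z))"
  by (rule continuous_on_compose2[OF assms]) auto

text \<open>With \<open>\<tau> = \<alpha> * t + c\<^sub>0\<close> and \<open>E\<close> the growing
  factor, \<open>E' = lam / \<tau> * E\<close>, and the similarity variable satisfies the same
  equation in time. Hence time derivatives turn into \<open>lam / \<tau>\<close> times expressions
  in \<open>\<xi>\<close>, which the profile equations match with the right-hand sides.\<close>

lemma shear_solution_of_profile:
  fixes \<alpha> n \<theta>\<^sub>0 c\<^sub>0 lam :: real and \<theta>\<^sub>s \<sigma>\<^sub>s U \<Sigma> \<Theta> U' \<Theta>' :: "real \<Rightarrow> real"
  assumes \<alpha>: "\<alpha> > 0" and lam: "lam > 0" and c\<^sub>0: "c\<^sub>0 = exp (\<alpha> * \<theta>\<^sub>0)"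
    and \<theta>\<^sub>s: "\<theta>\<^sub>s = (\<lambda>t. 1 / \<alpha> * ln (\<alpha> * t + c\<^sub>0))"
    and \<sigma>\<^sub>s: "\<sigma>\<^sub>s = (\<lambda>t. 1 / (\<alpha> * t + c\<^sub>0))"
    and U_pos: "\<And>x. U x > 0"
    and U': "\<And>x. (U has_real_derivative U' x) (at x)"
    and \<Sigma>': "\<And>x. (\<Sigma> has_real_derivative x * U x) (at x)"
    and \<Theta>': "\<And>x. (\<Theta> has_real_derivative \<Theta>' x) (at x)"
    and cont': "continuous_on UNIV U'" "continuous_on UNIV \<Theta>'"
    and energy: "\<And>x. lam * ((n + 1) / \<alpha> + x * \<Theta>' x) = \<Sigma> x * U x - 1"
    and stress: "\<And>x. \<Sigma> x = exp (- \<alpha> * \<Theta> x) * U x powr n"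
  shows "classical_shear_solution \<alpha> n
      (\<lambda>x t. (\<alpha> / c\<^sub>0 * t + 1) powr (lam / \<alpha>)
        * U (sqrt lam * x * (\<alpha> / c\<^sub>0 * t + 1) powr (lam / \<alpha>)))
      (\<lambda>x t. \<sigma>\<^sub>s t * (\<alpha> / c\<^sub>0 * t + 1) powr (- (lam / \<alpha>))
        * \<Sigma> (sqrt lam * x * (\<alpha> / c\<^sub>0 * t + 1) powr (lam / \<alpha>)))
      (\<lambda>x t. (1 + lam * ((n + 1) / \<alpha>)) * \<theta>\<^sub>s t - lam * ((n + 1) / \<alpha>) * \<theta>\<^sub>0
        + \<Theta> (sqrt lam * x * (\<alpha> / c\<^sub>0 * t + 1) powr (lam / \<alpha>)))"
proof -
  have c\<^sub>0_pos: "c\<^sub>0 > 0" by (simp add: c\<^sub>0)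
  define E where "E t = (\<alpha> / c\<^sub>0 * t + 1) powr (lam / \<alpha>)" for t
  define \<tau> where "\<tau> t = \<alpha> * t + c\<^sub>0" for t
  define \<xi> where "\<xi> x t = sqrt lam * x * E t" for x t
  have base: "\<alpha> / c\<^sub>0 * t + 1 = \<tau> t / c\<^sub>0" for t
    using c\<^sub>0_pos by (simp add: \<tau>_def add_divide_distrib)
  have \<tau>_pos: "\<tau> t > 0" if "t \<ge> 0" for t
    using that \<alpha> c\<^sub>0_pos by (simp add: \<tau>_def add_nonneg_pos)
  have E_pos: "E t > 0" if "t \<ge> 0" for t
    unfolding E_def base using \<tau>_pos[OF that] c\<^sub>0_pos by simp
  have E_inv: "(\<alpha> / c\<^sub>0 * t + 1) powr (- (lam / \<alpha>)) = 1 / E t" for t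
    by (simp add: E_def powr_minus_divide)
  have \<tau>': "(\<tau> has_real_derivative \<alpha>) (at t)" for t
    unfolding \<tau>_def by (auto intro!: derivative_eq_intros)
  \<comment> \<open>As \<open>\<tau> 0 = c\<^sub>0 > 0\<close>, the derivative is two-sided even at
    \<open>t = 0\<close>; the one-sided version is obtained later by restriction.\<close>
  have E': "(E has_real_derivative lam / \<tau> t * E t) (at t)" if "t \<ge> 0" for t
  proof -
    have p: "\<tau> t / c\<^sub>0 > 0" using \<tau>_pos[OF that] c\<^sub>0_pos by simp
    have "((\<lambda>t. (\<tau> t / c\<^sub>0) powr (lam / \<alpha>)) has_real_derivative
        lam / \<alpha> * (\<tau> t / c\<^sub>0) powr (lam / \<alpha> - 1) * (\<alpha> / c\<^sub>0)) (at t)"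
      by (rule DERIV_chain2[OF has_real_derivative_powr[OF p] DERIV_cdivide[OF \<tau>']])
    also have "lam / \<alpha> * (\<tau> t / c\<^sub>0) powr (lam / \<alpha> - 1) * (\<alpha> / c\<^sub>0) = lam / \<tau> t * (\<tau> t / c\<^sub>0) powr (lam / \<alpha>)"
      using p \<tau>_pos[OF that] \<alpha> c\<^sub>0_pos by (simp add: powr_diff)
    finally show ?thesis unfolding E_def base .
  qed
  have \<xi>_t: "((\<lambda>t. \<xi> x t) has_real_derivative lam / \<tau> t * \<xi> x t) (at t)" if "t \<ge> 0" for x t
    using DERIV_cmult[OF E'[OF that], of "sqrt lam * x"] by (simp add: \<xi>_def mult_ac)
  have \<xi>_x: "((\<lambda>x. \<xi> x t) has_real_derivative sqrt lam * E t) (at x)" for x t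
    unfolding \<xi>_def by (auto intro!: derivative_eq_intros)
  have cont: "continuous_on UNIV f" if "\<And>x. (f has_real_derivative f' x) (at x)" for f f' :: "real \<Rightarrow> real"
    using that by (intro continuous_at_imp_continuous_on ballI) (auto intro: DERIV_isCont)
  have snd_nonneg: "continuous_on (UNIV \<times> {0..}) (\<lambda>z. f (snd z))"
    if "\<And>t. t \<ge> 0 \<Longrightarrow> isCont f t" for f :: "real \<Rightarrow> real"
    using that by (intro continuous_on_compose2[of "{0..}" f _ snd] continuous_at_imp_continuous_on
        continuous_on_snd continuous_on_id) auto
  have E_cont: "continuous_on (UNIV \<times> {0..}) (\<lambda>z. E (snd z))"
    by (rule snd_nonneg) (rule DERIV_isCont[OF E'])
  have \<tau>_cont: "continuous_on (UNIV \<times> {0..}) (\<lambda>z. \<tau> (snd z))"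
    by (rule snd_nonneg) (rule DERIV_isCont[OF \<tau>'])
  have \<xi>_cont: "continuous_on (UNIV \<times> {0..}) (\<lambda>z. \<xi> (fst z) (snd z))"
    unfolding \<xi>_def by (intro continuous_intros E_cont)
  note conts = continuous_on_apply2[OF cont[OF U'] \<xi>_cont] continuous_on_apply2[OF cont[OF \<Sigma>'] \<xi>_cont]
    continuous_on_apply2[OF cont[OF \<Theta>'] \<xi>_cont]
    continuous_on_apply2[OF cont'(1) \<xi>_cont] continuous_on_apply2[OF cont'(2) \<xi>_cont]
    E_cont \<tau>_cont \<xi>_cont
  have nz: "\<forall>z\<in>UNIV \<times> {0..}. E (snd z) \<noteq> 0" "\<forall>z\<in>UNIV \<times> {0..}. \<tau> (snd z) \<noteq> 0"
    "\<forall>z\<in>UNIV \<times> {0..}. \<tau> (snd z) > 0"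
    using E_pos \<tau>_pos by (auto simp: less_imp_neq[symmetric])

  define u \<sigma> \<theta> where "u x t = E t * U (\<xi> x t)" and "\<sigma> x t = 1 / \<tau> t * (1 / E t) * \<Sigma> (\<xi> x t)"
    and "\<theta> x t = (1 + lam * ((n + 1) / \<alpha>)) * (1 / \<alpha> * ln (\<tau> t)) - lam * ((n + 1) / \<alpha>) * \<theta>\<^sub>0 + \<Theta> (\<xi> x t)"
    for x t
  define u\<^sub>t \<theta>\<^sub>t \<sigma>\<^sub>x where "u\<^sub>t x t = lam / \<tau> t * E t * (U (\<xi> x t) + \<xi> x t * U' (\<xi> x t))"
    and "\<theta>\<^sub>t x t = (1 + lam * ((n + 1) / \<alpha>) + lam * (\<xi> x t * \<Theta>' (\<xi> x t))) / \<tau> t"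
    and "\<sigma>\<^sub>x x t = sqrt lam / \<tau> t * (\<xi> x t * U (\<xi> x t))" for x t

  have u_pos: "\<forall>x. \<forall>t\<ge>0. u x t > 0"
    using E_pos U_pos by (simp add: u_def)
  have u\<sigma>\<theta>_cont: "\<forall>f\<in>{u, \<sigma>, \<theta>}. continuous_on (UNIV \<times> {0..}) (\<lambda>(x, t). f x t)"
    unfolding case_prod_beta ball_simps u_def \<sigma>_def \<theta>_def
    using nz \<alpha> by (auto intro!: continuous_intros conts)
  have "classical_shear_solution \<alpha> n u \<sigma> \<theta>"
    unfolding classical_shear_solution_def
  \<comment> \<open>The function \<open>u\<^sub>t\<close> is the witness for the second space
    derivative of the stress as well, so the momentum equation becomes the computation of that
    derivative.\<close>
  proof (rule conjI[OF u_pos conjI[OF u\<sigma>\<theta>_cont]], rule exI[of _ u\<^sub>t], rule exI[of _ \<theta>\<^sub>t],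
      rule exI[of _ \<sigma>\<^sub>x], rule exI[of _ u\<^sub>t], intro conjI allI impI)
    show "\<forall>f\<in>{u\<^sub>t, \<theta>\<^sub>t, \<sigma>\<^sub>x, u\<^sub>t}. continuous_on (UNIV \<times> {0..}) (\<lambda>(x, t). f x t)"
      unfolding case_prod_beta ball_simps u\<^sub>t_def \<theta>\<^sub>t_def \<sigma>\<^sub>x_def
      using nz \<alpha> by (auto intro!: continuous_intros conts)
    fix x t :: real
    assume t: "t \<ge> 0"
    note pos = E_pos[OF t] \<tau>_pos[OF t] U_pos[of "\<xi> x t"]
    have "((\<lambda>s. u x s) has_real_derivative
        lam / \<tau> t * E t * U (\<xi> x t) + U' (\<xi> x t) * (lam / \<tau> t * \<xi> x t) * E t) (at t)"
      unfolding u_def by (rule DERIV_mult[OF E'[OF t] DERIV_chain2[OF U' \<xi>_t[OF t]]])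
    then have "((\<lambda>s. u x s) has_real_derivative u\<^sub>t x t) (at t)"
      by (simp add: u\<^sub>t_def algebra_simps)
    then show "((\<lambda>s. u x s) has_real_derivative u\<^sub>t x t) (at t within {0..})"
      by (rule has_field_derivative_at_within)
    have "((\<lambda>s. \<theta> x s) has_real_derivative
        (1 + lam * ((n + 1) / \<alpha>)) * (1 / \<alpha> * (1 / \<tau> t * \<alpha>)) - 0 + \<Theta>' (\<xi> x t) * (lam / \<tau> t * \<xi> x t)) (at t)"
      unfolding \<theta>_def
      by (intro DERIV_add DERIV_diff DERIV_cmult DERIV_const DERIV_chain2[OF \<Theta>' \<xi>_t[OF t]]
          DERIV_chain2[OF DERIV_ln_divide[OF pos(2)] \<tau>'])
    then have "((\<lambda>s. \<theta> x s) has_real_derivative \<theta>\<^sub>t x t) (at t)"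
      using \<alpha> by (simp add: \<theta>\<^sub>t_def add_divide_distrib mult_ac)
    then show "((\<lambda>s. \<theta> x s) has_real_derivative \<theta>\<^sub>t x t) (at t within {0..})"
      by (rule has_field_derivative_at_within)
    have "((\<lambda>y. \<sigma> y t) has_real_derivative
        1 / \<tau> t * (1 / E t) * (\<xi> x t * U (\<xi> x t) * (sqrt lam * E t))) (at x)"
      unfolding \<sigma>_def by (intro DERIV_cmult DERIV_chain2[OF \<Sigma>' \<xi>_x])
    then show "((\<lambda>y. \<sigma> y t) has_real_derivative \<sigma>\<^sub>x x t) (at x)"
      using pos by (simp add: \<sigma>\<^sub>x_def mult_ac)
    have "((\<lambda>y. \<sigma>\<^sub>x y t) has_real_derivative sqrt lam / \<tau> t *
        (sqrt lam * E t * U (\<xi> x t) + U' (\<xi> x t) * (sqrt lam * E t) * \<xi> x t)) (at x)"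
      unfolding \<sigma>\<^sub>x_def by (intro DERIV_cmult DERIV_mult[OF \<xi>_x DERIV_chain2[OF U' \<xi>_x]])
    also have "sqrt lam / \<tau> t * (sqrt lam * E t * U (\<xi> x t) + U' (\<xi> x t) * (sqrt lam * E t) * \<xi> x t)
        = (sqrt lam * sqrt lam) / \<tau> t * E t * (U (\<xi> x t) + \<xi> x t * U' (\<xi> x t))"
      by (simp only: ring_distribs times_divide_eq_left times_divide_eq_right mult_ac)
    also have "\<dots> = u\<^sub>t x t"
      using lam by (simp add: u\<^sub>t_def)
    finally show "((\<lambda>y. \<sigma>\<^sub>x y t) has_real_derivative u\<^sub>t x t) (at x)" .
    show "u\<^sub>t x t = u\<^sub>t x t" ..
    \<comment> \<open>The numerator of \<open>\<theta>\<^sub>t\<close> is the left side of the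
      profile's energy equation plus 1. In \<open>\<sigma> * u\<close> the factors \<open>E\<close>
      and \<open>1 / E\<close> cancel.\<close>
    have "1 + lam * ((n + 1) / \<alpha>) + lam * (\<xi> x t * \<Theta>' (\<xi> x t)) = \<Sigma> (\<xi> x t) * U (\<xi> x t)"
      using energy[of "\<xi> x t"] by (simp add: distrib_left)
    then show "\<theta>\<^sub>t x t = \<sigma> x t * u x t"
      using pos by (simp add: \<theta>\<^sub>t_def \<sigma>_def u_def)
    define q where "q = lam / \<alpha>"
    \<comment> \<open>Here \<open>ln c\<^sub>0 = \<alpha> * \<theta>\<^sub>0\<close>. The formula
      gathers the terms of \<open>\<theta>\<close> in \<open>ln (\<tau> t)\<close> and
      \<open>\<theta>\<^sub>0\<close> into \<open>ln (\<tau> t) + (n + 1) * ln (E t)\<close>;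
      combined with \<open>E powr n\<close> from \<open>u powr n\<close>, one factor
      \<open>1 / E\<close> is left.\<close>
    have lnE: "ln (E t) = q * (ln (\<tau> t) - \<alpha> * \<theta>\<^sub>0)"
      unfolding E_def base using pos c\<^sub>0_pos by (simp add: q_def ln_powr ln_div) (simp add: c\<^sub>0)
    have "- \<alpha> * \<theta> x t = - ln (\<tau> t) - (n + 1) * ln (E t) - \<alpha> * \<Theta> (\<xi> x t)"
      unfolding lnE using \<alpha> by (simp add: \<theta>_def q_def field_simps)
    moreover have "u x t powr n = E t powr n * U (\<xi> x t) powr n"
      using pos by (simp add: u_def powr_mult)
    moreover have "E t powr n = exp (n * ln (E t))"
      using pos by (simp add: powr_def)
    ultimately have "exp (- \<alpha> * \<theta> x t) * u x t powr n
        = exp (- ln (\<tau> t) - (n + 1) * ln (E t) - \<alpha> * \<Theta> (\<xi> x t)) * (exp (n * ln (E t)) * U (\<xi> x t) powr n)"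
      by simp
    also have "\<dots> = exp (- ln (\<tau> t)) * exp (- ln (E t)) * (exp (- \<alpha> * \<Theta> (\<xi> x t)) * U (\<xi> x t) powr n)"
      by (simp add: algebra_simps flip: exp_add)
    also have "\<dots> = \<sigma> x t"
      using pos stress[of "\<xi> x t"] by (simp add: \<sigma>_def exp_minus inverse_eq_divide)
    finally show "\<sigma> x t = exp (- \<alpha> * \<theta> x t) * u x t powr n" ..
  qed
  then show ?thesis
    unfolding u_def[abs_def] \<sigma>_def[abs_def] \<theta>_def[abs_def] \<xi>_def \<theta>\<^sub>s \<sigma>\<^sub>s E_inv E_def[symmetric] \<tau>_def .
qed

text \<open>The whole-line profile serves twice: restricting its two-sided derivatives to the
  half-line gives the initial value problem, and inserting it into the similarity form gives the
  shear solution.\<close>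

theorem theorem6p1:
  fixes \<alpha> n \<theta>\<^sub>0 \<Sigma>\<^sub>0 c\<^sub>0 lam :: real and \<theta>\<^sub>s \<sigma>\<^sub>s :: "real \<Rightarrow> real"
  assumes "\<alpha> > 0" and "n > 0" and "\<theta>\<^sub>0 > 0" and "\<Sigma>\<^sub>0 > 0"
    and "c\<^sub>0 = exp (\<alpha> * \<theta>\<^sub>0)"
    and "\<theta>\<^sub>s = (\<lambda>t. 1 / \<alpha> * ln (\<alpha> * t + c\<^sub>0))"
    and "\<sigma>\<^sub>s = (\<lambda>t. 1 / (\<alpha> * t + c\<^sub>0))"
    and "lam > 0"
  shows "\<exists>U \<Sigma> \<Theta> :: real \<Rightarrow> real.
    even_function U \<and> even_function \<Sigma> \<and> even_function \<Theta> \<and>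
    solves_profile_ivp \<alpha> n lam \<Sigma>\<^sub>0 U \<Sigma> \<Theta> \<and>
    classical_shear_solution \<alpha> n
      (\<lambda>x t. (\<alpha> / c\<^sub>0 * t + 1) powr (lam / \<alpha>)
        * U (sqrt lam * x * (\<alpha> / c\<^sub>0 * t + 1) powr (lam / \<alpha>)))
      (\<lambda>x t. \<sigma>\<^sub>s t * (\<alpha> / c\<^sub>0 * t + 1) powr (- (lam / \<alpha>))
        * \<Sigma> (sqrt lam * x * (\<alpha> / c\<^sub>0 * t + 1) powr (lam / \<alpha>)))
      (\<lambda>x t. (1 + lam * ((n + 1) / \<alpha>)) * \<theta>\<^sub>s t - lam * ((n + 1) / \<alpha>) * \<theta>\<^sub>0
        + \<Theta> (sqrt lam * x * (\<alpha> / c\<^sub>0 * t + 1) powr (lam / \<alpha>)))"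
proof -
  obtain U \<Sigma> \<Theta> U' \<Theta>' where even: "even_function U" "even_function \<Sigma>" "even_function \<Theta>"
    and U_pos: "\<And>x. U x > 0" and \<Sigma>_0: "\<Sigma> 0 = \<Sigma>\<^sub>0"
    and U': "\<And>x. (U has_real_derivative U' x) (at x)"
    and \<Sigma>': "\<And>x. (\<Sigma> has_real_derivative x * U x) (at x)"
    and \<Theta>': "\<And>x. (\<Theta> has_real_derivative \<Theta>' x) (at x)"
    and cont': "continuous_on UNIV U'" "continuous_on UNIV \<Theta>'"
    and energy: "\<And>x. lam * ((n + 1) / \<alpha> + x * \<Theta>' x) = \<Sigma> x * U x - 1"
    and stress: "\<And>x. \<Sigma> x = exp (- \<alpha> * \<Theta> x) * U x powr n"
    using smooth_even_profile_exists[OF assms(1,2,8,4)] by blast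
  have U_cont: "continuous_on {0..} U"
    by (intro continuous_at_imp_continuous_on ballI DERIV_isCont[OF U'])
  have "solves_profile_ivp \<alpha> n lam \<Sigma>\<^sub>0 U \<Sigma> \<Theta>"
    unfolding solves_profile_ivp_def
  proof (rule conjI[OF _ conjI[OF U_cont conjI[OF _ \<Sigma>_0]]])
    show "\<forall>x\<ge>0. U x > 0" using U_pos by simp
    have "continuous_on {0..} (\<lambda>x. x * U x)" by (intro continuous_intros U_cont)
    moreover have "continuous_on {0..} \<Theta>'" by (rule continuous_on_subset[OF cont'(2)]) simp
    ultimately show "\<exists>\<Sigma>' \<Theta>'. continuous_on {0..} \<Sigma>' \<and> continuous_on {0..} \<Theta>' \<and>
      (\<forall>x\<ge>0. (\<Sigma> has_real_derivative \<Sigma>' x) (at x within {0..}) \<and>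
        (\<Theta> has_real_derivative \<Theta>' x) (at x within {0..}) \<and> \<Sigma>' x = x * U x \<and>
        lam * ((n + 1) / \<alpha> + x * \<Theta>' x) = \<Sigma> x * U x - 1 \<and>
        \<Sigma> x = exp (- \<alpha> * \<Theta> x) * U x powr n)"
      using energy stress has_field_derivative_at_within[OF \<Sigma>'] has_field_derivative_at_within[OF \<Theta>']
      by (intro exI[of _ "\<lambda>x. x * U x"] exI[of _ \<Theta>']) blast
  qed
  moreover note shear_solution_of_profile[OF assms(1,8,5-7) U_pos U' \<Sigma>' \<Theta>' cont' energy stress]
  ultimately show ?thesis using even by blast
qed

end
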